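(* There exists $n_0$ such that the following holds for every integer $n\ge n_0$ and every real $d$ with $12\le d\le\sqrt{n}$. Let $G=(V,E)$ be a graph on $|V|=n$ vertices satisfying the following two properties: (P1') for every $S\subset V$ with $|S|\le\frac{n\log d}{d\log n}$ we have $|N(S)|\ge d|S|$; (P2') there is an edge in $G$ between any two disjoint subsets $A,B\subseteq V$ such that $|A|,|B|\ge\frac{n\log d}{1035\log n}$. Then $G$ is Hamiltonian.
   Context: Graphs are finite and simple. $\log$ is the natural logarithm. For $S\subseteq V$, $N(S)=\{v\in V\setminus S : \exists u\in S,\ (u,v)\in E\}$ is the external neighborhood of $S$. A graph is Hamiltonian if it contains a cycle passing through all its vertices. *)

theory Defs
  imports Complex_Main "Graph_Theory.Pair_Digraph"
begin

text \<open>
  A finite simple graph is a \<^locale>\<open>pair_graph\<close>: a finite, loop-free, symmetric set of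
  arcs \<open>parcs G\<close> on the vertex set \<open>pverts G\<close>, where an undirected edge \<open>uv\<close> is represented
  by the two arcs \<open>(u, v)\<close> and \<open>(v, u)\<close>.
\<close>

definition ext_neighborhood :: "'a pair_pre_digraph \<Rightarrow> 'a set \<Rightarrow> 'a set" where
  "ext_neighborhood G S = {v \<in> pverts G - S. \<exists>u\<in>S. (u, v) \<in> parcs G}"

text \<open>
  The length bound is needed because \<^const>\<open>pre_digraph.cycle\<close> also accepts the closed walk
  \<open>u, v, u\<close> along the two arcs of a single edge, which is not a cycle of a simple graph.
\<close>

definition hamiltonian :: "'a pair_pre_digraph \<Rightarrow> bool" where
  "hamiltonian G \<longleftrightarrow>
     (\<exists>u p. pre_digraph.awalk (with_proj G) u p u \<and> pre_digraph.cycle (with_proj G) p \<and>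
        3 \<le> length p \<and> set (pre_digraph.awalk_verts (with_proj G) u p) = pverts G)"

end

theory Submission
  imports Defs "HOL-Library.Sublist" "HOL-Real_Asymp.Real_Asymp"
begin

text \<open>
  The proof is Posa's rotation technique, in the form that Hefetz, Krivelevich and Szabo gave it.
  Let \<open>M\<close> be the size from which on two disjoint vertex sets are joined by an edge, and write \<open>n\<close>
  for the number of vertices. Up to constants, \<open>M\<close> is \<open>n * ln d / ln n\<close>.

  A longest path \<open>P\<close> is rotated with one end fixed. A rotation deletes a path edge only at the new
  endpoint, so if \<open>U\<close> is the set of endpoints found so far, all edges of \<open>P\<close> that do not meet \<open>U\<close>
  are still present, and every neighbor of \<open>U\<close> that lies, together with both its neighbors on \<open>P\<close>,
  outside \<open>U\<close> yields a further endpoint. Expansion therefore multiplies the set of endpoints by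
  about \<open>d / 2\<close> in each round; after \<open>O(ln n / ln d)\<close> rounds it has \<open>M\<close> elements, and one more
  round, in which nearly all vertices are neighbors, leads to \<open>n / 3\<close> endpoints
  (\<open>many_ends_of_longest_path\<close>). Doing this at both ends gives \<open>n\<^sup>2 / 9\<close> pairs \<open>(a, b)\<close> that are
  joined by a path \<open>p (a, b)\<close> on the vertices of \<open>P\<close> in which at most some
  \<open>R = O(ln n / ln d)\<close> edges of \<open>P\<close> are missing (\<open>two_ended_paths\<close>).

  Cut \<open>P\<close> into \<open>2 * R\<close> segments of equal length. Each \<open>p (a, b)\<close> runs through at least half of
  them without interruption, and averaging produces two oriented segments \<open>S1\<close> and \<open>S2\<close> which a
  constant fraction of all the paths \<open>p (a, b)\<close> contain in this order (\<open>popular_segments\<close>). For the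
  sake of this step the rounds were counted: as \<open>R\<close> is small, the segments have length at least
  \<open>13 * M + 2\<close>, and this suffices to rotate inside a single segment. Indeed, after removal of fewer
  than \<open>M\<close> vertices, small subsets of \<open>S1\<close> expand well enough within \<open>S1\<close>; hence, once \<open>a\<close> is
  adjacent to one of many suitable vertices of \<open>S1\<close>, the path \<open>p (a, b)\<close> can be made to start at
  \<open>M\<close> different vertices of \<open>S1\<close> while everything behind \<open>S1\<close> stays as it is
  (\<open>many_ends_in_segment\<close>). The same holds for \<open>b\<close> and \<open>S2\<close>. As there are at least \<open>M\<close> choices of
  \<open>a\<close>, and then of \<open>b\<close>, such edges exist; finally some start in \<open>S1\<close> is adjacent to some end in
  \<open>S2\<close>, which closes a cycle on the vertices of \<open>P\<close>. No edge leaves a cycle on the vertex set of a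
  longest path, and both hypotheses on the graph together exclude this unless the cycle is
  spanning (\<open>closed_gpath_spans\<close>).
\<close>

section \<open>Edges of vertex lists\<close>

fun path_edges :: "'a list \<Rightarrow> 'a set set" where
  "path_edges (x # y # zs) = insert {x, y} (path_edges (y # zs))"
| "path_edges _ = {}"

lemma finite_path_edges [simp]: "finite (path_edges xs)"
  by (induction xs rule: path_edges.induct) auto

lemma path_edges_subset: "e \<in> path_edges xs \<Longrightarrow> e \<noteq> {} \<and> e \<subseteq> set xs"
  by (induction xs rule: path_edges.induct) auto

lemma path_edges_Cons:
  "path_edges (x # ys) = (if ys = [] then {} else insert {x, hd ys} (path_edges ys))"
  by (cases ys) auto

lemma path_edges_append:
  "path_edges (xs @ ys) = path_edges xs \<union> path_edges ys \<union>
     (if xs = [] \<or> ys = [] then {} else {{last xs, hd ys}})"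
  by (induction xs) (auto simp: path_edges_Cons)

lemma path_edges_rev [simp]: "path_edges (rev xs) = path_edges xs"
  by (induction xs) (auto simp: path_edges_Cons path_edges_append last_rev insert_commute)

lemma path_edges_nth: "Suc i < length xs \<Longrightarrow> {xs ! i, xs ! Suc i} \<in> path_edges xs"
proof (induction xs arbitrary: i rule: path_edges.induct)
  case (1 x y zs)
  then show ?case by (cases i) auto
qed auto

text \<open>
  For distinct entries, \<open>v\<close> lies on at most two edges of the list, so two known edges at \<open>v\<close> are all
  of them and the predecessor of \<open>v\<close> must be one of their other ends.
\<close>
lemma path_edges_pred:
  assumes "distinct (xs @ v # ys)" "xs \<noteq> []"
    and "{w1, v} \<in> path_edges (xs @ v # ys)" "{v, w2} \<in> path_edges (xs @ v # ys)" "w1 \<noteq> w2"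
  shows "last xs \<in> {w1, w2}"
proof -
  have *: "w = last xs \<or> (ys \<noteq> [] \<and> w = hd ys)" if "{w, v} \<in> path_edges (xs @ v # ys)" for w
  proof -
    from that have "{w, v} \<in> path_edges xs \<or> {w, v} \<in> path_edges ys \<or> {w, v} = {last xs, v}
        \<or> (ys \<noteq> [] \<and> {w, v} = {v, hd ys})"
      using assms(2) by (auto simp: path_edges_append path_edges_Cons split: if_splits)
    moreover have "{w, v} \<notin> path_edges xs" "{w, v} \<notin> path_edges ys"
      using assms(1) path_edges_subset by fastforce+
    ultimately show ?thesis by (auto simp: doubleton_eq_iff)
  qed
  show ?thesis
    using *[of w1] *[of w2] assms(3-5) by (auto simp: insert_commute)
qed

section \<open>Paths and rotations\<close>

context pair_graph
begin

lemma sym_parcs: "(u, v) \<in> parcs G \<Longrightarrow> (v, u) \<in> parcs G"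
  using pair_sym_arcs by (auto simp: symmetric_def sym_def)

definition gpath :: "'a list \<Rightarrow> bool" where
  "gpath p \<longleftrightarrow> p \<noteq> [] \<and> distinct p \<and> set p \<subseteq> pverts G \<and> successively (\<lambda>u v. (u, v) \<in> parcs G) p"

lemma gpath_rev [simp]: "gpath (rev p) \<longleftrightarrow> gpath p"
proof -
  have "(\<lambda>u v. (v, u) \<in> parcs G) = (\<lambda>u v. (u, v) \<in> parcs G)"
    using sym_parcs by blast
  then have "successively (\<lambda>u v. (v, u) \<in> parcs G) p = successively (\<lambda>u v. (u, v) \<in> parcs G) p"
    by (rule arg_cong)
  then show ?thesis by (simp add: gpath_def)
qed

lemma gpath_append:
  "gpath (p @ q) \<longleftrightarrow> (if p = [] then gpath q else if q = [] then gpath p else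
     gpath p \<and> gpath q \<and> set p \<inter> set q = {} \<and> (last p, hd q) \<in> parcs G)"
  by (auto simp: gpath_def successively_append_iff)

text \<open>
  Posa's rotation at the first vertex: the new edge from \<open>hd xs\<close> to \<open>v\<close> makes the edge from \<open>last xs\<close>
  to \<open>v\<close> superfluous, and \<open>last xs\<close> becomes the new first vertex.
\<close>
lemma rotation:
  assumes "gpath (xs @ v # ys)" "xs \<noteq> []" "(hd xs, v) \<in> parcs G"
  shows "gpath (rev xs @ v # ys)"
    and "path_edges (xs @ v # ys) \<subseteq> insert {last xs, v} (path_edges (rev xs @ v # ys))"
  using assms by (auto simp: gpath_append last_rev path_edges_append)

text \<open>
  The path \<open>Q\<close> results from rotations with the last vertex \<open>e\<close> fixed, seen from a list \<open>B\<close> that is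
  the rotated path itself or a segment of it. Instead of the rotations, only two of their effects are
  recorded: a bound \<open>k\<close> on the number of edges of \<open>B\<close> that were lost, and that each of these meets \<open>T\<close>,
  which stands for the set of first vertices that occurred on the way.
\<close>
definition rerouted :: "'a list \<Rightarrow> 'a set \<Rightarrow> 'a \<Rightarrow> nat \<Rightarrow> 'a set \<Rightarrow> 'a \<Rightarrow> 'a list \<Rightarrow> bool" where
  "rerouted B X e k T x Q \<longleftrightarrow> gpath Q \<and> set Q = X \<and> hd Q = x \<and> last Q = e \<and>
     card (path_edges B - path_edges Q) \<le> k \<and> (\<forall>f\<in>path_edges B - path_edges Q. f \<inter> T \<noteq> {})"

lemma rerouted_mono:
  assumes "rerouted B X e k T x Q" "k \<le> k'" "T \<subseteq> T'"
  shows "rerouted B X e k' T' x Q"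
proof -
  have "\<forall>f\<in>path_edges B - path_edges Q. f \<inter> T' \<noteq> {}"
    using assms(1,3) unfolding rerouted_def by blast
  then show ?thesis using assms(1,2) unfolding rerouted_def by linarith
qed

definition reachable_ends :: "'a list \<Rightarrow> 'a set \<Rightarrow> 'a \<Rightarrow> nat \<Rightarrow> 'a set \<Rightarrow> bool" where
  "reachable_ends B X e k T \<longleftrightarrow> (\<forall>x\<in>T. \<exists>Q. rerouted B X e k T x Q)"

lemma reachable_endsD: "reachable_ends B X e k T \<Longrightarrow> x \<in> T \<Longrightarrow> \<exists>Q. rerouted B X e k T x Q"
  by (simp add: reachable_ends_def)

text \<open>
  The edges of \<open>B\<close> at \<open>B ! Suc j\<close> do not meet \<open>T\<close>, hence they survive in every path that starts in \<open>T\<close>.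
  So, whichever way such a path passes \<open>B ! Suc j\<close>, its predecessor there is one of the two neighbors
  on \<open>B\<close>, and a rotation makes this predecessor the first vertex. The only edge lost contains it.
\<close>
lemma rotate_to_new_end:
  assumes T: "reachable_ends B X e k T" and B: "distinct B" "set B \<subseteq> X"
    and j: "Suc (Suc j) < length B"
    and notin: "B ! j \<notin> T" "B ! Suc j \<notin> T" "B ! Suc (Suc j) \<notin> T"
    and u: "u \<in> T" "(u, B ! Suc j) \<in> parcs G"
  shows "\<exists>w\<in>{B ! j, B ! Suc (Suc j)}. \<exists>Q. rerouted B X e (Suc k) (insert w T) w Q"
proof -
  let ?v = "B ! Suc j"
  obtain Q where Q: "rerouted B X e k T u Q"
    using T u(1) by (auto simp: reachable_ends_def)
  have miss: "\<forall>f\<in>path_edges B - path_edges Q. f \<inter> T \<noteq> {}"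
    using Q by (simp add: rerouted_def)
  have keep: "f \<in> path_edges Q" if "f \<in> path_edges B" "f \<inter> T = {}" for f
    using that miss by blast
  have e1: "{B ! j, ?v} \<in> path_edges Q"
    by (rule keep) (use notin path_edges_nth[of j B] j in auto)
  have e2: "{?v, B ! Suc (Suc j)} \<in> path_edges Q"
    by (rule keep) (use notin path_edges_nth[of "Suc j" B] j in auto)
  have "?v \<in> set Q" using Q B(2) j by (auto simp: rerouted_def)
  then obtain xs ys where Qs: "Q = xs @ ?v # ys" by (meson split_list)
  have xs: "xs \<noteq> []"
    using Q Qs u(1) notin(2) by (auto simp: rerouted_def)
  have hd: "hd xs = u" using Q Qs xs by (auto simp: rerouted_def)
  have ne: "B ! j \<noteq> B ! Suc (Suc j)" using B(1) j by (auto simp: nth_eq_iff_index_eq)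
  have gp: "gpath (xs @ ?v # ys)" using Q Qs by (simp add: rerouted_def)
  have w: "last xs \<in> {B ! j, B ! Suc (Suc j)}"
    by (rule path_edges_pred[OF _ xs _ _ ne]) (use gp e1 e2 Qs in \<open>auto simp: gpath_def\<close>)
  let ?Q = "rev xs @ ?v # ys"
  have rot: "gpath ?Q" "path_edges Q \<subseteq> insert {last xs, ?v} (path_edges ?Q)"
    using rotation[OF gp xs] hd u(2) Qs by auto
  have sub: "path_edges B - path_edges ?Q \<subseteq> insert {last xs, ?v} (path_edges B - path_edges Q)"
    using rot(2) by blast
  have "card (path_edges B - path_edges ?Q) \<le> card (insert {last xs, ?v} (path_edges B - path_edges Q))"
    by (rule card_mono) (use sub in auto)
  also have "\<dots> \<le> Suc (card (path_edges B - path_edges Q))"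
    by (rule card_insert_le_m1) auto
  finally have "card (path_edges B - path_edges ?Q) \<le> Suc k"
    using Q by (auto simp: rerouted_def)
  moreover have "hd ?Q = last xs" using xs by (simp add: hd_rev)
  moreover have "set ?Q = X" "last ?Q = e" using Q Qs by (auto simp: rerouted_def)
  moreover have "\<forall>f\<in>path_edges B - path_edges ?Q. f \<inter> insert (last xs) T \<noteq> {}"
    using sub miss by blast
  ultimately have "rerouted B X e (Suc k) (insert (last xs) T) (last xs) ?Q"
    using rot(1) by (auto simp: rerouted_def)
  then show ?thesis using w by blast
qed

lemma reachable_ends_Un:
  assumes "reachable_ends B X e k T"
    and "\<And>w. w \<in> W \<Longrightarrow> \<exists>Q. rerouted B X e (Suc k) (insert w T) w Q"
  shows "reachable_ends B X e (Suc k) (T \<union> W)"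
  unfolding reachable_ends_def
proof
  fix x assume "x \<in> T \<union> W"
  then consider "x \<in> T" | "x \<in> W" by blast
  then show "\<exists>Q. rerouted B X e (Suc k) (T \<union> W) x Q"
  proof cases
    case 1
    then obtain Q where "rerouted B X e k T x Q"
      using assms(1) by (auto simp: reachable_ends_def)
    then have "rerouted B X e (Suc k) (T \<union> W) x Q"
      by (rule rerouted_mono) auto
    then show ?thesis ..
  next
    case 2
    then obtain Q where "rerouted B X e (Suc k) (insert x T) x Q"
      using assms(2) by blast
    then have "rerouted B X e (Suc k) (T \<union> W) x Q"
      by (rule rerouted_mono) (use 2 in auto)
    then show ?thesis ..
  qed
qed

lemma finite_ext_neighborhood [simp]: "finite (ext_neighborhood G S)"
  using pair_finite_verts by (simp add: ext_neighborhood_def)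

text \<open>
  One round of rotations. Of the neighbors of \<open>T\<close>, at most \<open>2 * card T\<close> are next to a vertex of \<open>T\<close>
  on \<open>B\<close>, and one may be the last vertex of \<open>B\<close>; each of the others provides a new endpoint. A new
  endpoint is counted at most twice, once from either side. Thus \<open>T\<close> can be enlarged to half the size
  of its neighborhood, and also to any smaller size, because a part of the new endpoints may be
  discarded.
\<close>
lemma grow_endpoints:
  assumes T: "reachable_ends B X e k T" and B: "distinct B" "B \<noteq> []" "set B \<subseteq> X"
    and sub: "hd B \<in> T" "T \<subseteq> set B" "ext_neighborhood G T \<subseteq> set B"
    and s: "card T \<le> s" "2 * s \<le> card (ext_neighborhood G T)"
  shows "\<exists>T'. T \<subseteq> T' \<and> T' \<subseteq> set B \<and> card T' = s \<and> reachable_ends B X e (Suc k) T'"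
proof -
  let ?N = "ext_neighborhood G T"
  define I where "I = {j. Suc (Suc j) < length B \<and> B ! Suc j \<in> ?N \<and> B ! j \<notin> T \<and> B ! Suc (Suc j) \<notin> T}"
  have finI: "finite I" by (rule finite_subset[of _ "{..<length B}"]) (auto simp: I_def)
  have finT: "finite T" using sub(2) finite_subset by auto
  have "\<forall>j\<in>I. \<exists>i. (i = j \<or> i = Suc (Suc j)) \<and> (\<exists>Q. rerouted B X e (Suc k) (insert (B ! i) T) (B ! i) Q)"
  proof
    fix j assume j: "j \<in> I"
    then obtain u where u: "u \<in> T" "(u, B ! Suc j) \<in> parcs G"
      by (auto simp: I_def ext_neighborhood_def)
    have "B ! Suc j \<notin> T" using j by (auto simp: I_def ext_neighborhood_def)
    then have "\<exists>w\<in>{B ! j, B ! Suc (Suc j)}. \<exists>Q. rerouted B X e (Suc k) (insert w T) w Q"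
      using j by (intro rotate_to_new_end[OF T B(1,3) _ _ _ _ u]) (auto simp: I_def)
    then show "\<exists>i. (i = j \<or> i = Suc (Suc j)) \<and> (\<exists>Q. rerouted B X e (Suc k) (insert (B ! i) T) (B ! i) Q)"
      by blast
  qed
  then obtain f where f: "\<And>j. j \<in> I \<Longrightarrow> f j = j \<or> f j = Suc (Suc j)"
    "\<And>j. j \<in> I \<Longrightarrow> \<exists>Q. rerouted B X e (Suc k) (insert (B ! f j) T) (B ! f j) Q"
    by metis
  define W where "W = (!) B ` f ` I"
  have flt: "f j < length B" if "j \<in> I" for j
    using f(1)[OF that] that by (auto simp: I_def)
  have WB: "W \<subseteq> set B" using flt by (auto simp: W_def)
  then have finW: "finite W" using finite_subset by auto
  have WT: "W \<inter> T = {}" using f(1) by (fastforce simp: W_def I_def)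
  have "inj_on ((!) B) (f ` I)"
    by (rule inj_on_nth) (use B flt in auto)
  then have cW: "card W = card (f ` I)" by (simp add: W_def card_image)
  \<comment> \<open>A position \<open>j\<close> is determined by \<open>f j\<close> up to the side on which the new endpoint lies.\<close>
  have "I \<subseteq> f ` I \<union> (\<lambda>i. i - 2) ` f ` I"
  proof
    fix j assume "j \<in> I"
    then show "j \<in> f ` I \<union> (\<lambda>i. i - 2) ` f ` I"
      using f(1)[of j] by (auto simp: image_iff) (metis One_nat_def diff_Suc_1 diff_Suc_Suc numeral_2_eq_2)+
  qed
  then have "card I \<le> card (f ` I \<union> (\<lambda>i. i - 2) ` f ` I)"
    by (rule card_mono[rotated]) (use finI in auto)
  also have "\<dots> \<le> card (f ` I) + card ((\<lambda>i. i - 2) ` f ` I)" by (rule card_Un_le)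
  also have "\<dots> \<le> 2 * card W"
    using card_image_le[of "f ` I" "\<lambda>i. i - 2"] finI cW by simp
  finally have cI: "card I \<le> 2 * card W" .
  define J where "J = {j. j < length B \<and> B ! j \<in> T}"
  have finJ: "finite J" by (simp add: J_def)
  have cJ: "card J \<le> card T"
    by (rule card_inj_on_le[of "(!) B"]) (use B(1) finT in \<open>auto simp: J_def intro!: inj_on_nth\<close>)
  have "?N \<subseteq> (\<lambda>j. B ! Suc j) ` I \<union> {last B} \<union> (\<lambda>j. B ! Suc j) ` J \<union> (\<lambda>j. B ! (j - 1)) ` J"
  proof
    fix v assume v: "v \<in> ?N"
    then have "v \<in> set B" "v \<notin> T" using sub(3) by (auto simp: ext_neighborhood_def)
    then obtain i where i: "i < length B" "v = B ! i" by (auto simp: in_set_conv_nth)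
    have "i \<noteq> 0"
    proof
      assume "i = 0"
      then have "v = hd B" using i B(2) by (simp add: hd_conv_nth)
      then show False using sub(1) \<open>v \<notin> T\<close> by simp
    qed
    then obtain j where j: "i = Suc j" using not0_implies_Suc by blast
    consider "Suc (Suc j) = length B" | "B ! j \<in> T" | "Suc (Suc j) < length B" "B ! Suc (Suc j) \<in> T"
      | "Suc (Suc j) < length B" "B ! j \<notin> T" "B ! Suc (Suc j) \<notin> T"
      using i j by linarith
    then show "v \<in> (\<lambda>j. B ! Suc j) ` I \<union> {last B} \<union> (\<lambda>j. B ! Suc j) ` J \<union> (\<lambda>j. B ! (j - 1)) ` J"
    proof cases
      case 1
      then have "length B - 1 = Suc j" by simp
      then have "v = last B" using i j B(2) by (simp add: last_conv_nth)
      then show ?thesis by simp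
    next
      case 2
      then have "j \<in> J" using i j by (simp add: J_def)
      then show ?thesis using i j by blast
    next
      case 3
      then have "Suc (Suc j) \<in> J" by (simp add: J_def)
      moreover have "v = B ! (Suc (Suc j) - 1)" using i j by simp
      ultimately show ?thesis by blast
    next
      case 4
      then have "j \<in> I" using v i j by (simp add: I_def)
      then show ?thesis using i j by blast
    qed
  qed
  then have "card ?N \<le> card ((\<lambda>j. B ! Suc j) ` I \<union> {last B} \<union> (\<lambda>j. B ! Suc j) ` J \<union> (\<lambda>j. B ! (j - 1)) ` J)"
    by (rule card_mono[rotated]) (use finI finJ in auto)
  also have "\<dots> \<le> card ((\<lambda>j. B ! Suc j) ` I) + card {last B} + card ((\<lambda>j. B ! Suc j) ` J) + card ((\<lambda>j. B ! (j - 1)) ` J)"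
    by (meson add_le_mono card_Un_le le_refl le_trans)
  also have "\<dots> \<le> card I + 1 + card J + card J"
    by (intro add_mono card_image_le finI finJ) auto
  finally have "card ?N \<le> 2 * card W + 1 + 2 * card T" using cI cJ by simp
  then have "s - card T \<le> card W" using s by linarith
  then obtain W' where W': "W' \<subseteq> W" "card W' = s - card T"
    by (meson obtain_subset_with_card_n)
  have "reachable_ends B X e (Suc k) (T \<union> W')"
    by (rule reachable_ends_Un[OF T]) (use W'(1) f(2) in \<open>auto simp: W_def\<close>)
  moreover have "card (T \<union> W') = s"
    using W' WT finT finW finite_subset[OF W'(1) finW] s(1) by (subst card_Un_disjoint) auto
  ultimately show ?thesis using W'(1) WB sub(2) by (intro exI[of _ "T \<union> W'"]) auto
qed

end

section \<open>Longest paths with many endpoints\<close>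

context pair_graph
begin

definition joined :: "nat \<Rightarrow> bool" where
  "joined M \<longleftrightarrow> (\<forall>A B. A \<subseteq> pverts G \<and> B \<subseteq> pverts G \<and> A \<inter> B = {} \<and> M \<le> card A \<and> M \<le> card B
     \<longrightarrow> (\<exists>a\<in>A. \<exists>b\<in>B. (a, b) \<in> parcs G))"

definition longest_gpath :: "'a list \<Rightarrow> bool" where
  "longest_gpath P \<longleftrightarrow> gpath P \<and> (\<forall>Q. gpath Q \<longrightarrow> length Q \<le> length P)"

lemma ex_longest_gpath:
  assumes "pverts G \<noteq> {}" shows "\<exists>P. longest_gpath P"
proof -
  obtain v where "v \<in> pverts G" using assms by blast
  then have "gpath [v]" by (simp add: gpath_def)
  moreover have "\<forall>Q. gpath Q \<longrightarrow> length Q < Suc (card (pverts G))"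
    using pair_finite_verts by (auto simp: gpath_def less_Suc_eq_le card_mono simp flip: distinct_card)
  ultimately have "\<exists>P. gpath P \<and> (\<forall>Q. gpath Q \<longrightarrow> length Q \<le> length P)"
    by (rule ex_has_greatest_nat)
  then show ?thesis by (simp add: longest_gpath_def)
qed

lemma longest_gpath_cong:
  assumes "longest_gpath P" "gpath Q" "set Q = set P"
  shows "longest_gpath Q"
  using assms unfolding longest_gpath_def gpath_def by (metis distinct_card)

lemma longest_gpath_hd_neighbor:
  assumes "longest_gpath P" "(hd P, v) \<in> parcs G"
  shows "v \<in> set P"
proof (rule ccontr)
  assume "v \<notin> set P"
  moreover have "gpath [v]" using in_arcsD2[OF assms(2)] by (simp add: gpath_def)
  moreover have "gpath P" using assms(1) by (simp add: longest_gpath_def)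
  ultimately have "gpath ([v] @ P)"
    using sym_parcs[OF assms(2)] unfolding gpath_append by auto
  then show False using assms(1) unfolding longest_gpath_def by fastforce
qed

text \<open>
  All the rotated paths are longest paths too, and an endpoint of a longest path has no neighbor
  off the path.
\<close>
lemma neighbors_of_ends:
  assumes "longest_gpath P" "reachable_ends P (set P) e k T"
  shows "ext_neighborhood G T \<subseteq> set P"
proof
  fix v assume "v \<in> ext_neighborhood G T"
  then obtain u where u: "u \<in> T" "(u, v) \<in> parcs G" by (auto simp: ext_neighborhood_def)
  then obtain Q where "rerouted P (set P) e k T u Q" using assms(2) by (auto simp: reachable_ends_def)
  then show "v \<in> set P"
    using longest_gpath_hd_neighbor[of Q v] longest_gpath_cong[OF assms(1), of Q] u(2)
    by (auto simp: rerouted_def)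
qed

lemma reachable_ends_Suc:
  assumes "reachable_ends P X e k T" shows "reachable_ends P X e (Suc k) T"
  using reachable_ends_Un[OF assms, of "{}"] by simp

lemma joined_neighborhood:
  assumes "joined M" "T \<subseteq> pverts G" "M \<le> card T"
  shows "card (pverts G) < card T + card (ext_neighborhood G T) + M"
proof (rule ccontr)
  assume less: "\<not> ?thesis"
  let ?R = "pverts G - T - ext_neighborhood G T"
  have "finite T" using assms(2) pair_finite_verts by (rule finite_subset)
  have "pverts G \<subseteq> T \<union> ext_neighborhood G T \<union> ?R" by auto
  then have "card (pverts G) \<le> card (T \<union> ext_neighborhood G T \<union> ?R)"
    by (rule card_mono[rotated]) (use \<open>finite T\<close> pair_finite_verts in auto)
  also have "\<dots> \<le> card T + card (ext_neighborhood G T) + card ?R"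
    by (meson add_le_mono card_Un_le le_refl le_trans)
  finally have "M \<le> card ?R" using less by linarith
  moreover have "?R \<subseteq> pverts G" "T \<inter> ?R = {}" by auto
  ultimately obtain a b where "a \<in> T" "b \<in> ?R" "(a, b) \<in> parcs G"
    using assms unfolding joined_def by metis
  then show False by (auto simp: ext_neighborhood_def)
qed

definition expands :: "nat \<Rightarrow> real \<Rightarrow> bool" where
  "expands m d \<longleftrightarrow> (\<forall>S. S \<subseteq> pverts G \<and> card S \<le> m \<longrightarrow> d * real (card S) \<le> real (card (ext_neighborhood G S)))"

text \<open>
  As long as a set \<open>T\<close> of endpoints has at most \<open>min m M\<close> elements, a round multiplies it by at least
  \<open>(d - 1) / 2\<close>. A set larger than \<open>m\<close> need not expand any more, which is why the growth is stopped at
  exactly \<open>min m M\<close> and the next set is cut down to exactly \<open>M\<close>: fewer than \<open>M\<close> vertices outside it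
  are not adjacent to it, so its neighborhood has at least \<open>n - 2 * M\<close> vertices, and half of them
  are at least \<open>n / 3\<close>, where \<open>n\<close> is the number of all vertices.
\<close>
lemma many_ends_of_longest_path:
  assumes P: "longest_gpath P" and M: "joined M" "1 \<le> M" "6 * M \<le> card (pverts G)"
    and m: "expands m d" "1 \<le> m" "2 * real M \<le> d * real m"
    and d: "12 \<le> d" and t: "real m \<le> ((d - 1) / 2) ^ t"
  shows "\<exists>T. T \<subseteq> set P \<and> card (pverts G) \<le> 3 * card T \<and> reachable_ends P (set P) (last P) (t + 2) T"
proof -
  define c where "c = min m M"
  \<comment> \<open>The growth factor per round: \<open>N\<close> neighbors lead to \<open>N div 2\<close> endpoints, and the \<open>1\<close> pays for
  the rounding.\<close>
  define h where "h = (d - 1) / 2"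
  let ?re = "reachable_ends P (set P) (last P)"
  have P0: "P \<noteq> []" "distinct P" "set P \<subseteq> pverts G" "gpath P"
    using P by (auto simp: longest_gpath_def gpath_def)
  have grow: "\<exists>T'. T \<subseteq> T' \<and> T' \<subseteq> set P \<and> card T' = s \<and> ?re (Suc k) T'"
    if "?re k T" "hd P \<in> T" "T \<subseteq> set P" "card T \<le> s" "2 * s \<le> card (ext_neighborhood G T)" for k T s
    using grow_endpoints[OF that(1) P0(2,1) order_refl that(2,3) neighbors_of_ends[OF P that(1)] that(4,5)] .
  have "\<exists>T. hd P \<in> T \<and> T \<subseteq> set P \<and> card T \<le> c \<and> min (real c) (h ^ i) \<le> real (card T) \<and> ?re i T" for i
  proof (induction i)
    case 0
    have "?re 0 {hd P}"
      using P0 by (auto simp: reachable_ends_def rerouted_def intro!: exI[of _ P])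
    then show ?case using P0 m(2) M(2) by (intro exI[of _ "{hd P}"]) (auto simp: c_def)
  next
    case (Suc i)
    then obtain T where T: "hd P \<in> T" "T \<subseteq> set P" "card T \<le> c" "min (real c) (h ^ i) \<le> real (card T)" "?re i T"
      by blast
    show ?case
    proof (cases "card T = c")
      case True
      then show ?thesis using T reachable_ends_Suc by (intro exI[of _ T]) auto
    next
      case False
      define N where "N = card (ext_neighborhood G T)"
      have finT: "finite T" using T(2) finite_subset by auto
      have "0 < card T" using T(1) finT by (auto simp: card_gt_0_iff)
      then have T1: "1 \<le> real (card T)" by simp
      have "T \<subseteq> pverts G" "card T \<le> m" using T(2,3) P0(3) by (auto simp: c_def)
      then have dN: "d * card T \<le> N" using m(1) by (simp add: expands_def N_def)
      have "h * card T \<le> (real N - 1) / 2"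
        using dN T1 by (simp add: h_def field_simps)
      also have "\<dots> \<le> real (N div 2)"
      proof -
        have "N \<le> 2 * (N div 2) + 1" by linarith
        then have "real N \<le> real (2 * (N div 2) + 1)" by (simp only: of_nat_le_iff)
        then show ?thesis by simp
      qed
      finally have hN: "h * card T \<le> real (N div 2)" .
      have "1 * real (card T) \<le> h * card T" using d by (intro mult_right_mono) (auto simp: h_def)
      then have "card T \<le> min c (N div 2)" using hN T(3) by linarith
      moreover have "2 * min c (N div 2) \<le> card (ext_neighborhood G T)"
        unfolding N_def[symmetric] by linarith
      ultimately obtain T' where T': "T \<subseteq> T'" "T' \<subseteq> set P" "card T' = min c (N div 2)" "?re (Suc i) T'"
        using grow[OF T(5,1,2)] by blast
      have "h ^ i \<le> card T" using T(3,4) False by (auto simp: min_def split: if_splits)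
      then have "h * h ^ i \<le> h * card T" using d by (intro mult_left_mono) (auto simp: h_def)
      then have "min (real c) (h ^ Suc i) \<le> card T'" using hN T'(3) by (auto simp: min_def)
      then show ?thesis using T' T(1) by (intro exI[of _ T']) auto
    qed
  qed
  then obtain T where T: "hd P \<in> T" "T \<subseteq> set P" "card T \<le> c" "min (real c) (h ^ t) \<le> real (card T)" "?re t T"
    by blast
  have "real c \<le> h ^ t" using t by (auto simp: c_def h_def)
  then have cT: "card T = c" using T(3,4) by auto
  have "\<exists>T1. hd P \<in> T1 \<and> T1 \<subseteq> set P \<and> card T1 = M \<and> ?re (Suc t) T1"
  proof (cases "m < M")
    case True
    then have "card T = m" using cT by (simp add: c_def)
    then have "d * m \<le> card (ext_neighborhood G T)"
      using m(1) T(2) P0(3) by (auto simp: expands_def)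
    then have "2 * M \<le> card (ext_neighborhood G T)" using m(3) by linarith
    then show ?thesis using grow[OF T(5,1,2), of M] True \<open>card T = m\<close> T(1) by auto
  next
    case False
    then have "card T = M" using cT by (simp add: c_def)
    then show ?thesis using T(1,2) reachable_ends_Suc[OF T(5)] by (intro exI[of _ T]) simp
  qed
  then obtain T1 where T1: "hd P \<in> T1" "T1 \<subseteq> set P" "card T1 = M" "?re (Suc t) T1" by blast
  let ?N = "card (ext_neighborhood G T1)"
  have "card (pverts G) < M + ?N + M"
    using joined_neighborhood[OF M(1), of T1] T1 P0(3) by auto
  then have "M \<le> ?N div 2" "card (pverts G) \<le> 3 * (?N div 2)" using M(3) by linarith+
  then show ?thesis using grow[OF T1(4,1,2), of "?N div 2"] T1(3) by auto
qed

text \<open>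
  The lemma \<open>many_ends_of_longest_path\<close> is applied to \<open>P\<close>, and for each endpoint \<open>a\<close> obtained once more
  to the reversed new path, whose last vertex is then \<open>a\<close>. The edges lost add up.
\<close>
lemma two_ended_paths:
  assumes P: "longest_gpath P" and M: "joined M" "1 \<le> M" "6 * M \<le> card (pverts G)"
    and m: "expands m d" "1 \<le> m" "2 * real M \<le> d * real m"
    and d: "12 \<le> d" and t: "real m \<le> ((d - 1) / 2) ^ t"
  obtains \<Omega> p where "card (pverts G) \<le> 3 * length P" "\<Omega> \<subseteq> pverts G \<times> pverts G" "card (pverts G) * card (pverts G) \<le> 9 * card \<Omega>"
    "\<And>a b. (a, b) \<in> \<Omega> \<Longrightarrow> gpath (p (a, b)) \<and> set (p (a, b)) = set P \<and> hd (p (a, b)) = a \<and>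
       last (p (a, b)) = b \<and> card (path_edges P - path_edges (p (a, b))) \<le> 2 * (t + 2)"
proof -
  let ?n = "card (pverts G)"
  define good where "good a b Q \<longleftrightarrow> gpath Q \<and> set Q = set P \<and> hd Q = a \<and> last Q = b \<and>
    card (path_edges P - path_edges Q) \<le> 2 * (t + 2)" for a b Q
  have PV: "set P \<subseteq> pverts G" using P by (auto simp: longest_gpath_def gpath_def)
  obtain T where T: "T \<subseteq> set P" "?n \<le> 3 * card T" "reachable_ends P (set P) (last P) (t + 2) T"
    using many_ends_of_longest_path[OF P M m d t] by blast
  have "\<exists>B. B \<subseteq> set P \<and> ?n \<le> 3 * card B \<and> (\<forall>b\<in>B. \<exists>Q. good a b Q)" if aT: "a \<in> T" for a
  proof -
    obtain Q where Q: "rerouted P (set P) (last P) (t + 2) T a Q"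
      using reachable_endsD[OF T(3) aT] ..
    then have rQ: "gpath (rev Q)" "set (rev Q) = set P" by (auto simp: rerouted_def)
    have lQ: "last (rev Q) = a"
      using Q by (cases "Q = []") (auto simp: rerouted_def gpath_def last_rev)
    have "longest_gpath (rev Q)" by (rule longest_gpath_cong[OF P rQ(1,2)])
    from many_ends_of_longest_path[OF this M m d t]
    obtain B where B: "B \<subseteq> set P" "?n \<le> 3 * card B" "reachable_ends (rev Q) (set P) a (t + 2) B"
      unfolding rQ lQ by blast
    have "\<exists>R. good a b R" if "b \<in> B" for b
    proof -
      obtain R where R: "rerouted (rev Q) (set P) a (t + 2) B b R"
        using reachable_endsD[OF B(3) \<open>b \<in> B\<close>] ..
      have "path_edges P - path_edges R \<subseteq> (path_edges P - path_edges Q) \<union> (path_edges (rev Q) - path_edges R)"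
        by auto
      then have "card (path_edges P - path_edges R) \<le>
          card (path_edges P - path_edges Q) + card (path_edges (rev Q) - path_edges R)"
        by (meson card_Un_le card_mono finite_Diff finite_UnI finite_path_edges le_trans)
      also have "\<dots> \<le> 2 * (t + 2)" using Q R by (simp add: rerouted_def)
      finally have "card (path_edges P - path_edges (rev R)) \<le> 2 * (t + 2)" by simp
      moreover have "R \<noteq> []" using R by (auto simp: rerouted_def gpath_def)
      ultimately have "good a b (rev R)" using R by (simp add: good_def rerouted_def hd_rev last_rev)
      then show ?thesis ..
    qed
    then show ?thesis using B(1,2) by blast
  qed
  then obtain B where B: "\<And>a. a \<in> T \<Longrightarrow> B a \<subseteq> set P" "\<And>a. a \<in> T \<Longrightarrow> ?n \<le> 3 * card (B a)"
    "\<And>a b. a \<in> T \<Longrightarrow> b \<in> B a \<Longrightarrow> \<exists>Q. good a b Q" by metis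
  have finT: "finite T" using T(1) finite_subset by auto
  define \<Omega> where "\<Omega> = Sigma T B"
  define p where "p \<omega> = (SOME Q. good (fst \<omega>) (snd \<omega>) Q)" for \<omega>
  have p: "good a b (p (a, b))" if "(a, b) \<in> \<Omega>" for a b
    using someI_ex[OF B(3)[of a b]] that by (auto simp: \<Omega>_def p_def)
  show ?thesis
  proof (rule that)
    have "card T \<le> card (set P)" using T(1) by (intro card_mono) auto
    also have "\<dots> \<le> length P" by (rule card_length)
    finally show "?n \<le> 3 * length P" using T(2) by linarith
    show "\<Omega> \<subseteq> pverts G \<times> pverts G" using T(1) B(1) PV by (auto simp: \<Omega>_def)
    have "finite (B a)" if "a \<in> T" for a
      using B(1)[OF that] by (rule finite_subset) simp
    then have "card \<Omega> = (\<Sum>a\<in>T. card (B a))"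
      unfolding \<Omega>_def by (intro card_SigmaI finT) auto
    moreover have "card T * ?n \<le> (\<Sum>a\<in>T. 3 * card (B a))"
      using sum_mono[of T "\<lambda>_. ?n"] B(2) by simp
    ultimately have "card T * ?n \<le> 3 * card \<Omega>" by (simp flip: sum_distrib_left)
    moreover have "?n * ?n \<le> 3 * card T * ?n" using T(2) by (rule mult_right_mono) simp
    ultimately show "?n * ?n \<le> 9 * card \<Omega>" by linarith
    show "gpath (p (a, b)) \<and> set (p (a, b)) = set P \<and> hd (p (a, b)) = a \<and> last (p (a, b)) = b \<and>
       card (path_edges P - path_edges (p (a, b))) \<le> 2 * (t + 2)" if "(a, b) \<in> \<Omega>" for a b
      using p[OF that] by (simp add: good_def)
  qed
qed

end

section \<open>Segments of a path\<close>

text \<open>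
  A walk along the edges of a path that never returns to a vertex cannot turn around.
\<close>
lemma sublist_if_path_edges_subset:
  assumes "distinct P" "distinct S" "S \<noteq> []" "set S \<subseteq> set P" "path_edges S \<subseteq> path_edges P"
  shows "sublist S P \<or> sublist (rev S) P"
  using assms(2-)
proof (induction S)
  case (Cons x S)
  show ?case
  proof (cases "S = []")
    case True
    then show ?thesis using Cons.prems by (auto simp: sublist_def in_set_conv_decomp)
  next
    case False
    have IH: "sublist S P \<or> sublist (rev S) P"
      by (rule Cons.IH) (use Cons.prems False in \<open>auto simp: path_edges_Cons\<close>)
    \<comment> \<open>Reversing both lists exchanges the two alternatives, so it suffices to treat one of them.\<close>
    have *: "sublist (x # S) R \<or> sublist (rev (x # S)) R"
      if R: "distinct R" "set R = set P" "path_edges R = path_edges P" "sublist S R" for R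
    proof -
      obtain us vs where us: "R = us @ S @ vs" using R(4) by (auto simp: sublist_def)
      obtain y S' where S: "S = y # S'" using False by (cases S) auto
      have e: "{x, y} \<in> path_edges R" using Cons.prems R S by (auto simp: path_edges_Cons)
      have xS: "x \<notin> set S" using Cons.prems by simp
      have notin: "{x, y} \<notin> path_edges us" "{x, y} \<notin> path_edges S" "{x, y} \<notin> path_edges vs"
        using path_edges_subset[of "{x, y}"] R(1) us S xS by fastforce+
      have sub: "path_edges (us @ S @ vs) \<subseteq> path_edges us \<union> path_edges S \<union> path_edges vs \<union>
          (if us = [] then {} else {{last us, hd S}}) \<union> (if vs = [] then {} else {{last S, hd vs}})"
        using False by (auto simp: path_edges_append)
      have cases_Un: "us \<noteq> [] \<and> f = p \<or> vs \<noteq> [] \<and> f = q"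
        if "f \<in> A \<union> B \<union> C \<union> (if us = [] then {} else {p}) \<union> (if vs = [] then {} else {q})"
          "f \<notin> A" "f \<notin> B" "f \<notin> C" for f p q :: "'a set" and A B C
        using that by (auto split: if_splits)
      have "hd S = y" using S by simp
      then consider "us \<noteq> []" "{x, y} = {last us, y}" | "vs \<noteq> []" "{x, y} = {last S, hd vs}"
        using cases_Un[OF subsetD[OF sub e[unfolded us]] notin] by metis
      then show ?thesis
      proof cases
        case 1
        then have "x = last us" using xS S by (auto simp: doubleton_eq_iff)
        then have "us = butlast us @ [x]" using 1 by simp
        then have "R = butlast us @ (x # S) @ vs" using us by (metis append.assoc append_Cons append_Nil)
        then show ?thesis by (auto simp: sublist_def)
      next
        case 2
        have "last S \<noteq> x" using xS False by auto
        then have x: "x = hd vs" "y = last S" using 2 by (auto simp: doubleton_eq_iff)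
        have "S' = []"
        proof (rule ccontr)
          assume "S' \<noteq> []"
          then have "y \<in> set S'" using x(2) S by auto
          then show False using R(1) us S by auto
        qed
        then have "R = us @ rev (x # S) @ tl vs" using us S x(1) 2 by (simp add: hd_Cons_tl)
        then show ?thesis unfolding sublist_def by blast
      qed
    qed
    from IH show ?thesis
    proof
      assume "sublist S P"
      then show ?thesis using *[of P] assms(1) by simp
    next
      assume "sublist (rev S) P"
      then have "sublist S (rev P)" by (metis sublist_rev rev_rev_ident)
      then have "sublist (x # S) (rev P) \<or> sublist (rev (x # S)) (rev P)"
        using *[of "rev P"] assms(1) by simp
      then show ?thesis by (metis sublist_rev rev_rev_ident)
    qed
  qed
qed simp

lemma sublist_disjoint_split:
  assumes "sublist T (us @ S @ vs)" "S \<noteq> []" "set S \<inter> set T = {}"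
  shows "sublist T us \<or> sublist T vs"
proof -
  obtain as bs where eq: "us @ S @ vs = as @ T @ bs" using assms(1) by (auto simp: sublist_def)
  have hd: "hd S \<notin> set T" using assms(2,3) by (metis disjoint_iff hd_in_set)
  obtain zs where "us = as @ zs \<and> zs @ S @ vs = T @ bs \<or> us @ zs = as \<and> S @ vs = zs @ T @ bs"
    using eq unfolding append_eq_append_conv2[of us] by blast
  then show ?thesis
  proof
      assume *: "us = as @ zs \<and> zs @ S @ vs = T @ bs"
      then obtain ws where "zs @ ws = T \<and> S @ vs = ws @ bs \<or> zs = T @ ws \<and> ws @ S @ vs = bs"
        by (auto simp: append_eq_append_conv2)
      then show ?thesis
      proof
        assume ws: "zs @ ws = T \<and> S @ vs = ws @ bs"
        then have "ws = []" using hd assms(2) by (cases ws; cases S) auto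
        then have "us = as @ T @ []" using * ws by simp
        then show ?thesis unfolding sublist_def by blast
      next
        assume "zs = T @ ws \<and> ws @ S @ vs = bs"
        then show ?thesis using * by (auto simp: sublist_def)
      qed
    next
      assume *: "us @ zs = as \<and> S @ vs = zs @ T @ bs"
      then obtain ws where "S @ ws = zs \<and> vs = ws @ T @ bs \<or> S = zs @ ws \<and> ws @ vs = T @ bs"
        by (auto simp: append_eq_append_conv2)
      then show ?thesis
      proof
        assume "S @ ws = zs \<and> vs = ws @ T @ bs"
        then show ?thesis by (auto simp: sublist_def)
      next
        assume ws: "S = zs @ ws \<and> ws @ vs = T @ bs"
        have "ws = [] \<or> T = []"
          using ws assms(3) by (cases ws; cases T) auto
        then show ?thesis
        proof
          assume "ws = []"
          then have "vs = [] @ T @ bs" using ws by simp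
          then show ?thesis unfolding sublist_def by blast
        qed simp
      qed
    qed
  qed

definition in_order :: "'a list \<Rightarrow> 'a list \<Rightarrow> 'a list \<Rightarrow> bool" where
  "in_order S T P \<longleftrightarrow> (\<exists>pre mid post. P = pre @ S @ mid @ T @ post)"

lemma in_order_if_disjoint_sublists:
  assumes "sublist S P" "sublist T P" "S \<noteq> []" "set S \<inter> set T = {}"
  shows "in_order S T P \<or> in_order T S P"
proof -
  obtain us vs where P: "P = us @ S @ vs" using assms(1) by (auto simp: sublist_def)
  from sublist_disjoint_split[OF assms(2)[unfolded P] assms(3,4)] show ?thesis
  proof
    assume "sublist T us"
    then obtain as bs where "us = as @ T @ bs" by (auto simp: sublist_def)
    then have "P = as @ T @ bs @ S @ vs" using P by simp
    then show ?thesis unfolding in_order_def by blast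
  next
    assume "sublist T vs"
    then obtain as bs where "vs = as @ T @ bs" by (auto simp: sublist_def)
    then have "P = us @ S @ as @ T @ bs" using P by simp
    then show ?thesis unfolding in_order_def by blast
  qed
qed

definition segment :: "'a list \<Rightarrow> nat \<Rightarrow> nat \<Rightarrow> 'a list" where
  "segment P l i = take l (drop (i * l) P)"

lemma segment_split: "P = take (i * l) P @ segment P l i @ drop l (drop (i * l) P)"
  by (simp only: segment_def append_take_drop_id)

lemma segment_facts:
  assumes "distinct P"
  shows "distinct (segment P l i)" "set (segment P l i) \<subseteq> set P"
    "path_edges (segment P l i) \<subseteq> path_edges P"
proof -
  show "distinct (segment P l i)" using assms by (simp add: segment_def)
  show "set (segment P l i) \<subseteq> set P"
    by (subst (2) segment_split[of P i l]) auto
  show "path_edges (segment P l i) \<subseteq> path_edges P"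
    by (subst (2) segment_split[of P i l]) (auto simp: path_edges_append)
qed

lemma length_segment:
  assumes "i < K" "K * l \<le> length P" shows "length (segment P l i) = l"
proof -
  have "i * l + l \<le> K * l" using assms(1) by (metis add.commute mult_Suc mult_le_mono1 Suc_leI)
  then show ?thesis using assms(2) by (simp add: segment_def)
qed

lemma segments_disjoint:
  assumes "distinct P" "i < j"
  shows "set (segment P l i) \<inter> set (segment P l j) = {}"
proof -
  have le: "i * l + l \<le> j * l" using assms(2) by (metis add.commute mult_Suc mult_le_mono1 Suc_leI)
  have "segment P l i = take l (drop (i * l) (take (j * l) P))"
    using le by (simp add: segment_def take_drop min_def)
  then have "set (segment P l i) \<subseteq> set (take (j * l) P)"
    by (metis in_set_dropD in_set_takeD subsetI)
  moreover have "set (segment P l j) \<subseteq> set (drop (j * l) P)"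
    by (auto simp: segment_def dest: in_set_takeD)
  ultimately show ?thesis
    using assms(1) set_take_disj_set_drop_if_distinct[of P "j * l" "j * l"] by blast
qed

text \<open>
  The segments have disjoint sets of edges, so each broken one accounts for a missing edge of its own.
\<close>
lemma few_broken_segments:
  assumes "distinct P"
    and "\<And>i. i \<in> I \<Longrightarrow> \<not> path_edges (segment P l i) \<subseteq> E"
  shows "card I \<le> card (path_edges P - E)"
proof -
  have "\<forall>i\<in>I. \<exists>e. e \<in> path_edges (segment P l i) - E" using assms(2) by blast
  then obtain f where f: "\<And>i. i \<in> I \<Longrightarrow> f i \<in> path_edges (segment P l i) - E" by metis
  have "inj_on f I"
  proof (rule inj_onI, rule ccontr)
    fix i j assume ij: "i \<in> I" "j \<in> I" "f i = f j" "i \<noteq> j"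
    then have "f i \<noteq> {}" "f i \<subseteq> set (segment P l i) \<inter> set (segment P l j)"
      using f[of i] f[of j] path_edges_subset by fastforce+
    moreover have "set (segment P l i) \<inter> set (segment P l j) = {}"
      using segments_disjoint[OF assms(1)] ij(4) by (metis inf_commute linorder_neqE_nat)
    ultimately show False by blast
  qed
  moreover have "f ` I \<subseteq> path_edges P - E"
    using f segment_facts(3)[OF assms(1)] by blast
  ultimately show ?thesis by (intro card_inj_on_le) auto
qed

section \<open>Segments that many paths traverse\<close>

text \<open>
  Double counting of the pairs related by \<open>R\<close>, written without division.
\<close>
lemma popular_element:
  assumes "finite \<Sigma>" "\<Sigma> \<noteq> {}" "finite \<Omega>" "\<And>\<omega>. \<omega> \<in> \<Omega> \<Longrightarrow> c \<le> card {\<sigma> \<in> \<Sigma>. R \<sigma> \<omega>}"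
  shows "\<exists>\<sigma>\<in>\<Sigma>. card \<Omega> * c \<le> card \<Sigma> * card {\<omega> \<in> \<Omega>. R \<sigma> \<omega>}"
proof (rule ccontr)
  assume "\<not> ?thesis"
  then have less: "card \<Sigma> * card {\<omega> \<in> \<Omega>. R \<sigma> \<omega>} < card \<Omega> * c" if "\<sigma> \<in> \<Sigma>" for \<sigma>
    using that by (meson not_le)
  have "card \<Omega> * c \<le> (\<Sum>\<omega>\<in>\<Omega>. card {\<sigma> \<in> \<Sigma>. R \<sigma> \<omega>})"
    using sum_mono[of \<Omega> "\<lambda>_. c"] assms(4) by simp
  also have "\<dots> = (\<Sum>\<sigma>\<in>\<Sigma>. card {\<omega> \<in> \<Omega>. R \<sigma> \<omega>})"
    by (rule sum_multicount_gen[symmetric]) (use assms in auto)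
  finally have "card \<Sigma> * (card \<Omega> * c) \<le> (\<Sum>\<sigma>\<in>\<Sigma>. card \<Sigma> * card {\<omega> \<in> \<Omega>. R \<sigma> \<omega>})"
    by (simp flip: sum_distrib_left)
  also have "\<dots> < (\<Sum>\<sigma>\<in>\<Sigma>. card \<Omega> * c)"
    by (rule sum_strict_mono) (use assms less in auto)
  finally show False by simp
qed

text \<open>
  If \<open>L\<close> had fewer than \<open>M\<close> rows with at least \<open>M\<close> entries, these rows together would contain fewer
  than \<open>M * card V\<close> elements, and so would all the other rows together.
\<close>
lemma popular_rows:
  assumes V: "finite V" "V \<noteq> {}" and L: "L \<subseteq> V \<times> V" "2 * M * card V \<le> card L"
  shows "M \<le> card {a \<in> V. M \<le> card {b \<in> V. (a, b) \<in> L}}"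
proof (rule ccontr)
  let ?f = "\<lambda>a. card {b \<in> V. (a, b) \<in> L}"
  let ?A = "{a \<in> V. M \<le> ?f a}"
  assume less: "\<not> ?thesis"
  have n: "0 < card V" using V by (simp add: card_gt_0_iff)
  have "L = Sigma V (\<lambda>a. {b \<in> V. (a, b) \<in> L})" using L(1) by auto
  then have "card L = card (Sigma V (\<lambda>a. {b \<in> V. (a, b) \<in> L}))" by (rule arg_cong)
  also have "\<dots> = (\<Sum>a\<in>V. ?f a)" using V(1) by (intro card_SigmaI) auto
  also have "\<dots> \<le> (\<Sum>a\<in>V. (if a \<in> ?A then card V else 0) + (M - 1))"
    by (rule sum_mono) (use V(1) in \<open>auto intro!: trans_le_add1 card_mono\<close>)
  also have "\<dots> = card ?A * card V + card V * (M - 1)"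
    using V(1) by (simp add: sum.distrib sum.If_cases Int_def conj_commute)
  also have "\<dots> \<le> (M - 1) * card V + card V * (M - 1)"
    using less by (intro add_right_mono mult_right_mono) auto
  also have "\<dots> < 2 * M * card V" using less n by (cases M) auto
  finally show False using L(2) by simp
qed

text \<open>
  Any path \<open>p \<omega>\<close> contains at least half of the \<open>4 * r\<close> segments, each in one of two directions. So
  each ordered pair of different segments among them occurs in \<open>p \<omega>\<close> for some choice of two directions
  and of the order along \<open>p \<omega>\<close>. There are \<open>8 * (4 * r)\<^sup>2\<close> combinations of two indices and three binary
  choices, and \<open>p \<omega>\<close> realizes at least \<open>2 * r * (2 * r - 1) \<ge> 3 * r\<^sup>2\<close> of them. Averaging gives the
  fraction \<open>3 / 128\<close>, which is independent of \<open>r\<close>.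
\<close>
lemma popular_segments:
  fixes p :: "'b \<Rightarrow> 'a list"
  assumes P: "distinct P" "4 * r * l \<le> length P" "2 \<le> r" "1 \<le> l" and fin: "finite \<Omega>"
    and p: "\<And>\<omega>. \<omega> \<in> \<Omega> \<Longrightarrow> distinct (p \<omega>) \<and> set (p \<omega>) = set P \<and> card (path_edges P - path_edges (p \<omega>)) \<le> 2 * r"
  shows "\<exists>S T. length S = l \<and> length T = l \<and> 3 * card \<Omega> \<le> 128 * card {\<omega> \<in> \<Omega>. in_order S T (p \<omega>)}"
proof -
  define ori :: "bool \<Rightarrow> 'a list \<Rightarrow> 'a list" where "ori o1 S = (if o1 then rev S else S)" for o1 S
  define fs where "fs = (\<lambda>(i :: nat, j :: nat, o1, o2, sw). if sw then ori o2 (segment P l j) else ori o1 (segment P l i))"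
  define sn where "sn = (\<lambda>(i :: nat, j :: nat, o1, o2, sw). if sw then ori o1 (segment P l i) else ori o2 (segment P l j))"
  define R where "R \<sigma> \<omega> = in_order (fs \<sigma>) (sn \<sigma>) (p \<omega>)" for \<sigma> \<omega>
  define \<Sigma> :: "(nat \<times> nat \<times> bool \<times> bool \<times> bool) set"
    where "\<Sigma> = {..<4 * r} \<times> {..<4 * r} \<times> UNIV \<times> UNIV \<times> UNIV"
  have finS: "finite \<Sigma>" by (simp add: \<Sigma>_def)
  have cS: "card \<Sigma> = 128 * r\<^sup>2"
    by (simp add: \<Sigma>_def card_cartesian_product power2_eq_square del: UNIV_Times_UNIV)
  have neS: "\<Sigma> \<noteq> {}" using cS P(3) by auto
  have len: "length (segment P l i) = l" if "i < 4 * r" for i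
    using length_segment[OF that, of l P] P(2) by simp
  have c: "3 * r\<^sup>2 \<le> card {\<sigma> \<in> \<Sigma>. R \<sigma> \<omega>}" if w: "\<omega> \<in> \<Omega>" for \<omega>
  proof -
    define U where "U = {i \<in> {..<4 * r}. path_edges (segment P l i) \<subseteq> path_edges (p \<omega>)}"
    have "card ({..<4 * r} - U) \<le> card (path_edges P - path_edges (p \<omega>))"
      by (rule few_broken_segments[OF P(1), of _ l]) (auto simp: U_def)
    then have "card ({..<4 * r} - U) \<le> 2 * r" using p[OF w] by linarith
    moreover have "card ({..<4 * r} - U) = 4 * r - card U"
      by (subst card_Diff_subset) (auto simp: U_def)
    ultimately have "2 * r \<le> card U" by simp
    then obtain U' where U': "U' \<subseteq> U" "card U' = 2 * r" by (meson obtain_subset_with_card_n)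
    have finU: "finite U'" using U'(1) by (rule finite_subset) (simp add: U_def)
    let ?D = "U' \<times> U' - (\<lambda>i. (i, i)) ` U'"
    have sub: "sublist (segment P l i) (p \<omega>) \<or> sublist (rev (segment P l i)) (p \<omega>)" if "i \<in> U'" for i
    proof (rule sublist_if_path_edges_subset)
      have i: "i < 4 * r" "path_edges (segment P l i) \<subseteq> path_edges (p \<omega>)" using that U'(1) by (auto simp: U_def)
      show "distinct (p \<omega>)" "path_edges (segment P l i) \<subseteq> path_edges (p \<omega>)" using p[OF w] i by auto
      show "segment P l i \<noteq> []" using len[OF i(1)] P(4) by auto
      show "distinct (segment P l i)" "set (segment P l i) \<subseteq> set (p \<omega>)"
        using segment_facts[OF P(1)] p[OF w] by auto
    qed
    have "?D \<subseteq> (\<lambda>(i, j, _). (i, j)) ` {\<sigma> \<in> \<Sigma>. R \<sigma> \<omega>}"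
    proof
      fix x assume "x \<in> ?D"
      then obtain i j where ij: "x = (i, j)" "i \<in> U'" "j \<in> U'" "i \<noteq> j" by auto
      have lt: "i < 4 * r" "j < 4 * r" using ij U'(1) by (auto simp: U_def)
      obtain o1 where o1: "sublist (ori o1 (segment P l i)) (p \<omega>)"
        using sub[OF ij(2)] by (metis ori_def)
      obtain o2 where o2: "sublist (ori o2 (segment P l j)) (p \<omega>)"
        using sub[OF ij(3)] by (metis ori_def)
      have "segment P l i \<noteq> []" using len[OF lt(1)] P(4) by auto
      then have "ori o1 (segment P l i) \<noteq> []" by (simp add: ori_def)
      moreover have "set (segment P l i) \<inter> set (segment P l j) = {}"
        using segments_disjoint[OF P(1)] ij(4) by (metis inf_commute linorder_neqE_nat)
      then have "set (ori o1 (segment P l i)) \<inter> set (ori o2 (segment P l j)) = {}"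
        by (simp add: ori_def)
      ultimately have "in_order (ori o1 (segment P l i)) (ori o2 (segment P l j)) (p \<omega>) \<or>
        in_order (ori o2 (segment P l j)) (ori o1 (segment P l i)) (p \<omega>)"
        by (rule in_order_if_disjoint_sublists[OF o1 o2])
      then have "R (i, j, o1, o2, False) \<omega> \<or> R (i, j, o1, o2, True) \<omega>"
        by (simp add: R_def fs_def sn_def)
      then obtain sw where "R (i, j, o1, o2, sw) \<omega>" by blast
      moreover have "(i, j, o1, o2, sw) \<in> \<Sigma>" using lt by (simp add: \<Sigma>_def)
      ultimately have "(i, j, o1, o2, sw) \<in> {\<sigma> \<in> \<Sigma>. R \<sigma> \<omega>}" by simp
      then show "x \<in> (\<lambda>(i, j, _). (i, j)) ` {\<sigma> \<in> \<Sigma>. R \<sigma> \<omega>}"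
        by (rule image_eqI[rotated]) (simp add: ij(1))
    qed
    then have "card ?D \<le> card ((\<lambda>(i, j, _). (i, j)) ` {\<sigma> \<in> \<Sigma>. R \<sigma> \<omega>})"
      by (rule card_mono[rotated]) (use finS in auto)
    also have "\<dots> \<le> card {\<sigma> \<in> \<Sigma>. R \<sigma> \<omega>}" by (rule card_image_le) (use finS in auto)
    finally have "card ?D \<le> card {\<sigma> \<in> \<Sigma>. R \<sigma> \<omega>}" .
    moreover have "card ?D = 2 * r * (2 * r) - 2 * r"
    proof -
      have "card ((\<lambda>i. (i, i)) ` U') = 2 * r" using U'(2) by (subst card_image) (auto simp: inj_on_def)
      then show ?thesis using finU U'(2) by (subst card_Diff_subset) (auto simp: card_cartesian_product)
    qed
    moreover have "3 * r\<^sup>2 \<le> 2 * r * (2 * r) - 2 * r"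
    proof -
      have "2 * r \<le> r * r" using P(3) by (rule mult_right_mono) simp
      moreover have "2 * r * (2 * r) = 4 * (r * r)" by simp
      ultimately show ?thesis unfolding power2_eq_square by linarith
    qed
    ultimately show ?thesis by linarith
  qed
  have "\<exists>\<sigma>\<in>\<Sigma>. card \<Omega> * (3 * r\<^sup>2) \<le> card \<Sigma> * card {\<omega> \<in> \<Omega>. R \<sigma> \<omega>}"
    by (rule popular_element[OF finS neS fin]) (rule c)
  then obtain \<sigma> where s: "\<sigma> \<in> \<Sigma>" "card \<Omega> * (3 * r\<^sup>2) \<le> card \<Sigma> * card {\<omega> \<in> \<Omega>. R \<sigma> \<omega>}"
    by blast
  from s(2) have "r\<^sup>2 * (3 * card \<Omega>) \<le> r\<^sup>2 * (128 * card {\<omega> \<in> \<Omega>. R \<sigma> \<omega>})"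
    unfolding cS by (simp add: algebra_simps)
  then have "3 * card \<Omega> \<le> 128 * card {\<omega> \<in> \<Omega>. R \<sigma> \<omega>}" using P(3) by simp
  moreover have "length (fs \<sigma>) = l" "length (sn \<sigma>) = l"
    using s(1) len by (auto simp: fs_def sn_def ori_def \<Sigma>_def)
  ultimately show ?thesis unfolding R_def by blast
qed

section \<open>Rotations inside one segment\<close>

context pair_graph
begin

text \<open>
  The positions are those where a rotation at an element of \<open>Y\<close> leads to an endpoint in \<open>C\<close>, whichever
  of the two neighbors on \<open>S\<close> it is; they are shifted by one to begin at the left neighbor.
\<close>
definition flanked :: "'a list \<Rightarrow> 'a set \<Rightarrow> 'a set \<Rightarrow> nat set" where
  "flanked S C Y = {j. Suc (Suc j) < length S \<and> S ! Suc j \<in> Y \<and> S ! j \<in> C \<and> S ! Suc (Suc j) \<in> C}"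

lemma finite_flanked [simp]: "finite (flanked S C Y)"
  by (rule finite_subset[of _ "{..<length S}"]) (auto simp: flanked_def)

text \<open>
  Remove from \<open>S\<close> a largest set \<open>D\<close> of fewer than \<open>M\<close> vertices that does not expand into its complement.
  If some small \<open>X\<close> in the complement did not expand either, then \<open>D \<union> X\<close> would not, and by the choice of
  \<open>D\<close> it would have between \<open>M\<close> and \<open>2 * M\<close> elements. Each of its elements spoils at most three
  positions by lying at, before or after them, and at most three more per element are in its
  neighborhood. This leaves at least \<open>13 * M - 6 * 2 * M = M\<close> vertices not adjacent to \<open>D \<union> X\<close>, but sets of
  this size are joined.
\<close>
lemma expanding_core:
  assumes M: "joined M" "1 \<le> M" and S: "distinct S" "set S \<subseteq> pverts G" "13 * M + 2 \<le> length S"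
  obtains C where "C \<subseteq> set S" "card (set S - C) < M"
    "\<And>X. X \<subseteq> C \<Longrightarrow> X \<noteq> {} \<Longrightarrow> card X \<le> M \<Longrightarrow> 3 * card X \<le> card (flanked S C (ext_neighborhood G X))"
proof -
  define bad where "bad D \<longleftrightarrow> D \<subseteq> set S \<and> card (flanked S (set S - D) (ext_neighborhood G D)) \<le> 3 * card D" for D
  have "bad {}" by (simp add: bad_def flanked_def ext_neighborhood_def)
  then have "\<exists>D. (bad D \<and> card D < M) \<and> (\<forall>D'. bad D' \<and> card D' < M \<longrightarrow> card D' \<le> card D)"
    by (intro ex_has_greatest_nat[of _ "{}" card M]) (use M in auto)
  then obtain D where D: "bad D" "card D < M" and max: "\<And>D'. bad D' \<Longrightarrow> card D' < M \<Longrightarrow> card D' \<le> card D"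
    by blast
  let ?C = "set S - D"
  have DS: "D \<subseteq> set S" using D by (simp add: bad_def)
  then have finD: "finite D" using finite_subset by auto
  show ?thesis
  proof (rule that[of ?C])
    show "?C \<subseteq> set S" by auto
    have "set S - ?C = D" using DS by auto
    then show "card (set S - ?C) < M" using D by simp
    fix X assume X: "X \<subseteq> ?C" "X \<noteq> {}" "card X \<le> M"
    show "3 * card X \<le> card (flanked S ?C (ext_neighborhood G X))"
    proof (rule ccontr)
      assume less: "\<not> ?thesis"
      have finX: "finite X" using X(1) by (meson List.finite_set finite_Diff finite_subset)
      let ?D = "D \<union> X"
      have cD: "card ?D = card D + card X"
        using X(1) finX finD by (intro card_Un_disjoint) auto
      have "flanked S (set S - ?D) (ext_neighborhood G ?D)
          \<subseteq> flanked S (set S - D) (ext_neighborhood G D) \<union> flanked S ?C (ext_neighborhood G X)"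
        by (auto simp: flanked_def ext_neighborhood_def)
      then have "card (flanked S (set S - ?D) (ext_neighborhood G ?D))
          \<le> card (flanked S (set S - D) (ext_neighborhood G D)) + card (flanked S ?C (ext_neighborhood G X))"
        by (meson card_Un_le card_mono finite_UnI finite_flanked le_trans)
      also have "\<dots> \<le> 3 * card ?D" using D less cD by (simp add: bad_def)
      finally have fl: "card (flanked S (set S - ?D) (ext_neighborhood G ?D)) \<le> 3 * card ?D" .
      have "?D \<subseteq> set S" using DS X(1) by auto
      with fl have "bad ?D" by (simp add: bad_def)
      moreover have "card X > 0" using X(2) finX by (simp add: card_gt_0_iff)
      ultimately have DM: "M \<le> card ?D" using max[of ?D] cD by linarith
      have D2M: "card ?D \<le> 2 * M" using cD D(2) X(3) by linarith
      define Y where "Y = {j. Suc (Suc j) < length S \<and> S ! j \<notin> ?D \<and> S ! Suc j \<notin> ?D \<and> S ! Suc (Suc j) \<notin> ?D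
        \<and> S ! Suc j \<notin> ext_neighborhood G ?D}"
      define H where "H i = {j. Suc (Suc j) < length S \<and> S ! (i + j) \<in> ?D}" for i
      have cH: "card (H i) \<le> card ?D" if "i \<le> 2" for i
        by (rule card_inj_on_le[of "\<lambda>j. S ! (i + j)"])
           (use that S(1) finD finX in \<open>auto simp: H_def inj_on_def nth_eq_iff_index_eq\<close>)
      have finH: "finite (H i)" for i
        by (rule finite_subset[of _ "{..<length S}"]) (auto simp: H_def)
      have finY: "finite Y"
        by (rule finite_subset[of _ "{..<length S}"]) (auto simp: Y_def)
      have "{..<length S - 2} \<subseteq> Y \<union> H 0 \<union> H 1 \<union> H 2 \<union> flanked S (set S - ?D) (ext_neighborhood G ?D)"
        by (auto simp: Y_def H_def flanked_def)
      then have "card {..<length S - 2} \<le> card (Y \<union> H 0 \<union> H 1 \<union> H 2 \<union> flanked S (set S - ?D) (ext_neighborhood G ?D))"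
        by (rule card_mono[rotated]) (use finY finH in auto)
      also have "\<dots> \<le> card Y + card (H 0) + card (H 1) + card (H 2) + card (flanked S (set S - ?D) (ext_neighborhood G ?D))"
        by (meson add_le_mono card_Un_le le_refl le_trans)
      also have "\<dots> \<le> card Y + 6 * card ?D"
        using cH[of 0] cH[of 1] cH[of 2] fl by simp
      finally have "length S - 2 \<le> card Y + 6 * card ?D" by simp
      then have cY: "M \<le> card Y" using D2M S(3) by linarith
      let ?Y = "(\<lambda>j. S ! Suc j) ` Y"
      have "card ?Y = card Y"
        by (rule card_image) (use S(1) in \<open>auto simp: inj_on_def Y_def nth_eq_iff_index_eq\<close>)
      moreover have "?Y \<subseteq> pverts G" using S(2) by (auto simp: Y_def)
      moreover have "?D \<subseteq> pverts G" using S(2) DS X(1) by auto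
      moreover have "?D \<inter> ?Y = {}" by (auto simp: Y_def)
      ultimately obtain a b where ab: "a \<in> ?D" "b \<in> ?Y" "(a, b) \<in> parcs G"
        using M(1) cY DM unfolding joined_def by metis
      then have "b \<in> ext_neighborhood G ?D"
        using \<open>?Y \<subseteq> pverts G\<close> \<open>?D \<inter> ?Y = {}\<close> by (auto simp: ext_neighborhood_def)
      then show False using ab(2) by (auto simp: Y_def)
    qed
  qed
qed

text \<open>
  Let \<open>C\<close> be the expanding core of \<open>S\<close> and \<open>X\<close> the set of vertices preceded on \<open>S\<close> by one in \<open>C\<close>. An
  edge from the first vertex of \<open>pre @ S\<close> to \<open>X\<close> allows a rotation after which the path starts in \<open>C\<close>.
  From then on the endpoints can be kept in \<open>C\<close>: a set of \<open>s\<close> endpoints has neighbors at \<open>3 * s\<close>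
  positions flanked by \<open>C\<close>, and at most \<open>2 * s\<close> of these have an endpoint found earlier next to them. So
  one endpoint at a time can be added. Since \<open>pre @ S\<close> keeps its last vertex, whatever follows \<open>S\<close> on
  a longer path is not affected.
\<close>
lemma many_ends_in_segment:
  assumes M: "joined M" "1 \<le> M" and S: "distinct S" "set S \<subseteq> pverts G" "13 * M + 2 \<le> length S"
  obtains X where "X \<subseteq> set S" "2 * M \<le> card X"
    "\<And>x pre. x \<in> X \<Longrightarrow> gpath (pre @ S) \<Longrightarrow> (hd (pre @ S), x) \<in> parcs G \<Longrightarrow>
       \<exists>Y\<subseteq>set S. M \<le> card Y \<and> (\<forall>y\<in>Y. \<exists>Q. gpath Q \<and> set Q = set (pre @ S) \<and> hd Q = y \<and> last Q = last S)"
proof -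
  obtain C where C: "C \<subseteq> set S" "card (set S - C) < M"
    and exp: "\<And>X. X \<subseteq> C \<Longrightarrow> X \<noteq> {} \<Longrightarrow> card X \<le> M \<Longrightarrow> 3 * card X \<le> card (flanked S C (ext_neighborhood G X))"
    using expanding_core[OF M S] by blast
  define J where "J = {j. Suc j < length S \<and> S ! j \<in> C}"
  let ?X = "(\<lambda>j. S ! Suc j) ` J"
  have finJ: "finite J" by (rule finite_subset[of _ "{..<length S}"]) (auto simp: J_def)
  have cX: "card ?X = card J"
    by (rule card_image) (use S(1) in \<open>auto simp: inj_on_def J_def nth_eq_iff_index_eq\<close>)
  have "set S \<subseteq> (set S - C) \<union> {last S} \<union> (!) S ` J"
  proof
    fix v assume "v \<in> set S"
    then obtain i where i: "i < length S" "v = S ! i" by (auto simp: in_set_conv_nth)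
    show "v \<in> (set S - C) \<union> {last S} \<union> (!) S ` J"
    proof (cases "Suc i = length S")
      case True
      then have "v = last S" using i by (metis One_nat_def diff_Suc_1' last_conv_nth length_0_conv nat.distinct(1))
      then show ?thesis by simp
    next
      case False
      then show ?thesis using i by (auto simp: J_def)
    qed
  qed
  then have "card (set S) \<le> card ((set S - C) \<union> {last S} \<union> (!) S ` J)"
    by (rule card_mono[rotated]) (use finJ in auto)
  also have "\<dots> \<le> card (set S - C) + card {last S} + card ((!) S ` J)"
    by (meson add_le_mono card_Un_le le_refl le_trans)
  also have "\<dots> \<le> M + 1 + card J"
    by (intro add_mono card_image_le finJ) (use C in auto)
  finally have "2 * M \<le> card ?X" using S(1,3) cX M(2) by (simp add: distinct_card)
  moreover have "?X \<subseteq> set S" by (auto simp: J_def)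
  moreover have "\<exists>Y\<subseteq>set S. M \<le> card Y \<and> (\<forall>y\<in>Y. \<exists>Q. gpath Q \<and> set Q = set (pre @ S) \<and> hd Q = y \<and> last Q = last S)"
    if x: "x \<in> ?X" and pre: "gpath (pre @ S)" "(hd (pre @ S), x) \<in> parcs G" for x pre
  proof -
    obtain i where i: "x = S ! Suc i" "Suc i < length S" "S ! i \<in> C" using x by (auto simp: J_def)
    let ?xs = "pre @ take (Suc i) S" and ?ys = "drop (Suc (Suc i)) S"
    have split: "pre @ S = ?xs @ x # ?ys"
      using i by (simp add: Cons_nth_drop_Suc)
    have xs: "?xs \<noteq> []" using i by auto
    have "hd ?xs = hd (pre @ S)" using xs by (metis split hd_append2)
    then have rot: "gpath (rev ?xs @ x # ?ys)"
      "path_edges (pre @ S) \<subseteq> insert {last ?xs, x} (path_edges (rev ?xs @ x # ?ys))"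
      using rotation[of ?xs x ?ys] pre xs split by auto
    have last: "last ?xs = S ! i" using i by (simp add: take_Suc_conv_app_nth)
    let ?E = "set (pre @ S)"
    have "rerouted S ?E (last S) 1 {S ! i} (S ! i) (rev ?xs @ x # ?ys)"
    proof -
      have sub: "path_edges S - path_edges (rev ?xs @ x # ?ys) \<subseteq> {{S ! i, x}}"
        using rot(2) last by (auto simp: path_edges_append)
      then have "card (path_edges S - path_edges (rev ?xs @ x # ?ys)) \<le> 1"
        using card_mono[OF _ sub] by simp
      moreover have "set (rev ?xs @ x # ?ys) = ?E" by (subst split) auto
      moreover have "hd (rev ?xs @ x # ?ys) = S ! i"
        by (metis hd_append2 hd_rev last rev_is_Nil_conv xs)
      moreover have "last (rev ?xs @ x # ?ys) = last S"
      proof -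
        have "last (rev ?xs @ x # ?ys) = last (pre @ S)" by (subst split) simp
        also have "\<dots> = last S" using i(2) by (intro last_appendR) auto
        finally show ?thesis .
      qed
      moreover have "\<forall>f\<in>path_edges S - path_edges (rev ?xs @ x # ?ys). f \<inter> {S ! i} \<noteq> {}"
        using sub by auto
      ultimately show ?thesis unfolding rerouted_def using rot(1) by blast
    qed
    then have base: "reachable_ends S ?E (last S) 1 {S ! i}" by (auto simp: reachable_ends_def)
    have "\<exists>k T. T \<subseteq> C \<and> card T = s \<and> reachable_ends S ?E (last S) k T" if "1 \<le> s" "s \<le> M" for s
      using that
    proof (induction s rule: dec_induct)
      case base
      then show ?case using \<open>reachable_ends S ?E (last S) 1 {S ! i}\<close> i(3)
        by (intro exI[of _ 1] exI[of _ "{S ! i}"]) auto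
    next
      case (step s)
      then obtain k T where T: "T \<subseteq> C" "card T = s" "reachable_ends S ?E (last S) k T" by auto
      have finT: "finite T" using T(1) C(1) by (meson List.finite_set finite_subset)
      have "T \<noteq> {}" using T(2) step by auto
      then have ex: "3 * s \<le> card (flanked S C (ext_neighborhood G T))"
        using exp[of T] T step by simp
      define H where "H i = {j. Suc (Suc j) < length S \<and> S ! (i + j) \<in> T}" for i
      have cH: "card (H i) \<le> card T" if "i \<le> 2" for i
        by (rule card_inj_on_le[of "\<lambda>j. S ! (i + j)"])
           (use that S(1) finT in \<open>auto simp: H_def inj_on_def nth_eq_iff_index_eq\<close>)
      have finH: "finite (H i)" for i
        by (rule finite_subset[of _ "{..<length S}"]) (auto simp: H_def)
      have "\<not> flanked S C (ext_neighborhood G T) \<subseteq> H 0 \<union> H 2"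
      proof
        assume "flanked S C (ext_neighborhood G T) \<subseteq> H 0 \<union> H 2"
        then have "card (flanked S C (ext_neighborhood G T)) \<le> card (H 0) + card (H 2)"
          by (meson card_Un_le card_mono finH finite_UnI le_trans)
        then show False using ex cH[of 0] cH[of 2] T(2) step by simp
      qed
      then obtain j where j: "Suc (Suc j) < length S" "S ! Suc j \<in> ext_neighborhood G T"
        "S ! j \<in> C" "S ! Suc (Suc j) \<in> C" "S ! j \<notin> T" "S ! Suc (Suc j) \<notin> T"
        by (auto simp: flanked_def H_def)
      then obtain u where u: "u \<in> T" "(u, S ! Suc j) \<in> parcs G" "S ! Suc j \<notin> T"
        by (auto simp: ext_neighborhood_def)
      have "\<exists>w\<in>{S ! j, S ! Suc (Suc j)}. \<exists>Q. rerouted S ?E (last S) (Suc k) (insert w T) w Q"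
        by (rule rotate_to_new_end[OF T(3) S(1) _ j(1,5) u(3) j(6) u(1,2)]) auto
      then obtain w where w: "w \<in> C" "w \<notin> T" "\<exists>Q. rerouted S ?E (last S) (Suc k) (insert w T) w Q"
        using j by blast
      have "reachable_ends S ?E (last S) (Suc k) (T \<union> {w})"
        by (rule reachable_ends_Un[OF T(3)]) (use w in auto)
      then show ?case using w T finT by (intro exI[of _ "Suc k"] exI[of _ "T \<union> {w}"]) auto
    qed
    from this[OF M(2) order_refl]
    obtain k T where T: "T \<subseteq> C" "card T = M" "reachable_ends S ?E (last S) k T"
      by blast
    then show ?thesis using C(1)
      by (intro exI[of _ T]) (auto simp: reachable_ends_def rerouted_def; blast)
  qed
  ultimately show ?thesis by (intro that[of ?X]) auto
qed

end

section \<open>Hamiltonian cycles\<close>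

lemma arcs_of_vertex_list:
  assumes "ws \<noteq> []"
  shows "pawalk_verts (hd ws) (zip ws (tl ws)) = ws \<and> pcas (hd ws) (zip ws (tl ws)) (last ws)"
  using assms
proof (induction ws rule: induct_list012)
  case (3 x y zs)
  then show ?case by simp
qed auto

lemma successively_imp_zip_subset:
  "successively (\<lambda>u v. (u, v) \<in> E) ws \<Longrightarrow> set (zip ws (tl ws)) \<subseteq> E"
  by (induction ws rule: induct_list012) auto

context pair_graph
begin

lemma hamiltonian_if_closed_gpath:
  assumes C: "gpath C" "(last C, hd C) \<in> parcs G" "set C = pverts G" "3 \<le> length C"
  shows "hamiltonian G"
proof -
  define ws where "ws = C @ [hd C]"
  define p where "p = zip ws (tl ws)"
  have C0: "C \<noteq> []" "distinct C" using C(1) by (auto simp: gpath_def)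
  have hdlast: "hd ws = hd C" "last ws = hd C" "ws \<noteq> []" using C0 by (auto simp: ws_def)
  have tlws: "tl ws = tl C @ [hd C]" using C0 by (simp add: ws_def)
  have "successively (\<lambda>u v. (u, v) \<in> parcs G) ws"
    using C(1,2) by (auto simp: ws_def gpath_def successively_append_iff)
  then have arcs: "set p \<subseteq> parcs G" unfolding p_def by (rule successively_imp_zip_subset)
  have verts: "pawalk_verts (hd C) p = ws" and cas: "pcas (hd C) p (hd C)"
    using arcs_of_vertex_list[OF hdlast(3)] hdlast(1,2) by (auto simp: p_def)
  have "length p = length C" using C0 by (simp add: p_def tlws) (simp add: ws_def)
  then have p3: "3 \<le> length p" using C(4) by simp
  have "set ws = insert (hd C) (set C)" by (simp add: ws_def)
  then have setws: "set ws = pverts G" using C(3) hd_in_set[OF C0(1)] by (simp only: insert_absorb)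
  have "hd C \<notin> set (tl C)" "distinct (tl C)" using C0 by (cases C; auto)+
  then have dist: "distinct (tl ws)" by (simp add: tlws)
  have awalk: "pre_digraph.awalk (with_proj G) (hd C) p (hd C)"
    using arcs cas C(3) C0 by (auto simp: pre_digraph.awalk_def cas_with_proj_eq)
  moreover have "pre_digraph.cycle (with_proj G) p"
    unfolding pre_digraph.cycle_def
    using awalk dist verts p3 by (intro exI[of _ "hd C"]) (auto simp: awalk_verts_with_proj_eq)
  ultimately show ?thesis
    unfolding hamiltonian_def using p3 setws verts
    by (intro exI[of _ "hd C"] exI[of _ p]) (simp add: awalk_verts_with_proj_eq)
qed

lemma replace_prefix:
  assumes "gpath (xs @ ys)" "gpath xs'" "set xs' = set xs" "last xs' = last xs"
  shows "gpath (xs' @ ys)"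
  using assms by (cases "xs = []") (auto simp: gpath_append split: if_splits)

text \<open>
  The sets may overlap, so \<open>M\<close> elements of \<open>A\<close> are taken out of \<open>B\<close> first.
\<close>
lemma joined_edge:
  assumes "joined M" "A \<subseteq> pverts G" "B \<subseteq> pverts G" "M \<le> card A" "2 * M \<le> card B"
  shows "\<exists>a\<in>A. \<exists>b\<in>B. (a, b) \<in> parcs G"
proof -
  obtain A' where A': "A' \<subseteq> A" "card A' = M" using assms(4) by (meson obtain_subset_with_card_n)
  have "finite A'" using A'(1) assms(2) pair_finite_verts by (meson finite_subset order_trans)
  then have "card B - card A' \<le> card (B - A')" by (rule diff_card_le_card_Diff)
  then have "M \<le> card (B - A')" using A'(2) assms(5) by linarith
  moreover have "A' \<subseteq> pverts G" "B - A' \<subseteq> pverts G" "A' \<inter> (B - A') = {}" "M \<le> card A'"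
    using A' assms(2,3) by auto
  ultimately have "\<exists>a\<in>A'. \<exists>b\<in>B - A'. (a, b) \<in> parcs G"
    using assms(1) unfolding joined_def by blast
  then show ?thesis using A'(1) by blast
qed

text \<open>
  A cycle on the vertices of a longest path can be opened at any vertex, so no edge leaves it. By \<open>joined\<close>
  its complement has fewer than \<open>M\<close> vertices. If there are at most \<open>m\<close> of them, they have a
  neighbor elsewhere by expansion; otherwise some \<open>m\<close> of them have \<open>d * m \<ge> 2 * M\<close> neighbors, too many to
  lie in the complement.
\<close>
lemma closed_gpath_spans:
  assumes P: "longest_gpath P" and C: "gpath C" "set C = set P" "(last C, hd C) \<in> parcs G"
    and M: "joined M" "M \<le> card (set P)"
    and m: "expands m d" "1 \<le> m" "2 * real M \<le> d * real m" "0 < d"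
  shows "set C = pverts G"
proof (rule ccontr)
  assume ne: "set C \<noteq> pverts G"
  let ?S = "pverts G - set P"
  have no_edge: "(v, w) \<notin> parcs G" if "v \<in> set P" "w \<in> ?S" for v w
  proof
    assume vw: "(v, w) \<in> parcs G"
    have "v \<in> set C" using that(1) C(2) by simp
    from split_list[OF this] obtain xs ys where split: "C = xs @ v # ys" by blast
    have "gpath ((v # ys) @ xs)"
    proof (cases "xs = []")
      case False
      then show ?thesis using C(1,3) unfolding split by (simp only: gpath_append) auto
    qed (use C(1) split in simp)
    moreover have "set ((v # ys) @ xs) = set P" using C(2) split by auto
    ultimately have "longest_gpath ((v # ys) @ xs)" by (rule longest_gpath_cong[OF P])
    then have "w \<in> set ((v # ys) @ xs)" using longest_gpath_hd_neighbor vw by force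
    then show False using that(2) C(2) split by auto
  qed
  have S0: "?S \<noteq> {}" using ne C P by (auto simp: longest_gpath_def gpath_def)
  have PV: "set P \<subseteq> pverts G" using P by (auto simp: longest_gpath_def gpath_def)
  have finS: "finite ?S" using pair_finite_verts by simp
  have "card ?S < M"
  proof (rule ccontr)
    assume "\<not> ?thesis"
    then have "\<exists>a\<in>set P. \<exists>b\<in>?S. (a, b) \<in> parcs G"
      using M PV unfolding joined_def by (metis Diff_disjoint Diff_subset not_less)
    then show False using no_edge by blast
  qed
  obtain S' where S': "S' \<subseteq> ?S" "card S' = min m (card ?S)"
    by (meson min.cobounded2 obtain_subset_with_card_n)
  have "0 < card ?S" using S0 finS by (simp add: card_gt_0_iff)
  have N: "ext_neighborhood G S' \<subseteq> ?S - S'"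
    using no_edge sym_parcs S'(1) by (fastforce simp: ext_neighborhood_def)
  have "S' \<subseteq> pverts G" "card S' \<le> m" using S' by auto
  then have dN: "d * card S' \<le> card (ext_neighborhood G S')" using m(1) by (simp add: expands_def)
  show False
  proof (cases "card ?S \<le> m")
    case True
    then have "S' = ?S" using S' finS by (intro card_subset_eq) auto
    then have "ext_neighborhood G S' = {}" using N by blast
    then have "d * card S' \<le> 0" using dN by simp
    moreover have "0 < real (card S')" using \<open>S' = ?S\<close> \<open>0 < card ?S\<close> by simp
    ultimately show False using m(4) by (simp add: mult_le_0_iff)
  next
    case False
    then have "card S' = m" "m < M" using S'(2) \<open>card ?S < M\<close> by auto
    then have "2 * real M \<le> card (ext_neighborhood G S')"
      using dN m(3) \<open>card S' = m\<close> by simp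
    also have "\<dots> \<le> real (card ?S)"
      using card_mono[OF finS] N by auto
    finally show False using \<open>card ?S < M\<close> by simp
  qed
qed

text \<open>
  Of the constants, \<open>768 = 2 * 9 * 128 / 3\<close> makes a fraction \<open>3 / 128\<close> of \<open>n\<^sup>2 / 9\<close> pairs at least
  \<open>2 * M * n\<close>, as \<open>popular_rows\<close> demands. The last assumption provides for \<open>4 * (t + 2)\<close> segments of
  length \<open>13 * M + 2\<close> on a path with at least \<open>n / 3\<close> vertices; this is twice as many segments as edges
  can be missing.
\<close>
lemma hamiltonian_if_expanding:
  assumes M: "joined M" "1 \<le> M" "768 * M \<le> card (pverts G)"
    and m: "expands m d" "1 \<le> m" "2 * real M \<le> d * real m"
    and d: "12 \<le> d" and t: "real m \<le> ((d - 1) / 2) ^ t"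
    and size: "12 * (t + 2) * (13 * M + 2) \<le> card (pverts G)"
  shows "hamiltonian G"
proof -
  let ?n = "card (pverts G)"
  define l where "l = 13 * M + 2"
  have l: "13 * M + 2 \<le> l" "12 * (t + 2) * l \<le> ?n" using size by (auto simp: l_def)
  have V0: "pverts G \<noteq> {}" using M(2,3) by auto
  obtain P where P: "longest_gpath P" using ex_longest_gpath[OF V0] by blast
  have P': "gpath P" "distinct P" "set P \<subseteq> pverts G"
    using P by (auto simp: longest_gpath_def gpath_def)
  have M6: "6 * M \<le> ?n" using M(3) by linarith
  obtain \<Omega> p where lenP: "?n \<le> 3 * length P" and \<Omega>: "\<Omega> \<subseteq> pverts G \<times> pverts G" "?n * ?n \<le> 9 * card \<Omega>"
    and p: "\<And>a b. (a, b) \<in> \<Omega> \<Longrightarrow> gpath (p (a, b)) \<and> set (p (a, b)) = set P \<and> hd (p (a, b)) = a \<and>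
       last (p (a, b)) = b \<and> card (path_edges P - path_edges (p (a, b))) \<le> 2 * (t + 2)"
    using two_ended_paths[OF P M(1,2) M6 m d t] by blast
  have fin\<Omega>: "finite \<Omega>" using \<Omega>(1) pair_finite_verts finite_subset by blast
  have "12 * (t + 2) * l = 3 * (4 * (t + 2) * l)" by simp
  then have l4: "4 * (t + 2) * l \<le> length P" using l(2) lenP by linarith
  obtain S1 S2 where S: "length S1 = l" "length S2 = l"
    "3 * card \<Omega> \<le> 128 * card {\<omega> \<in> \<Omega>. in_order S1 S2 (p \<omega>)}"
    using popular_segments[OF P'(2) l4 _ _ fin\<Omega>, of p] p l(1) by (force simp: gpath_def)
  define L where "L = {\<omega> \<in> \<Omega>. in_order S1 S2 (p \<omega>)}"
  have "768 * M * ?n \<le> ?n * ?n" using M(3) by (rule mult_right_mono) simp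
  then have cL: "2 * M * ?n \<le> card L" using \<Omega>(2) S(3) unfolding L_def[symmetric] by linarith
  have LV: "L \<subseteq> pverts G \<times> pverts G" using \<Omega>(1) by (auto simp: L_def)
  let ?row = "\<lambda>a. {b \<in> pverts G. (a, b) \<in> L}"
  have rows: "M \<le> card {a \<in> pverts G. M \<le> card (?row a)}"
    by (rule popular_rows[OF pair_finite_verts V0 LV cL])
  have dec: "\<exists>pre mid post. p (a, b) = pre @ S1 @ mid @ S2 @ post" if "(a, b) \<in> L" for a b
    using that by (simp add: L_def in_order_def)
  have S12: "distinct S1" "set S1 \<subseteq> pverts G" "distinct (rev S2)" "set (rev S2) \<subseteq> pverts G"
    "set S1 \<inter> set S2 = {}"
  proof -
    have "0 < M * ?n" using M(2) V0 pair_finite_verts by (simp add: card_gt_0_iff)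
    then have "0 < card L" using cL by linarith
    then obtain \<omega> where "\<omega> \<in> L" by (metis card.empty equals0I less_irrefl)
    moreover obtain a b where "\<omega> = (a, b)" by (cases \<omega>)
    ultimately have ab: "(a, b) \<in> L" by simp
    then obtain pre mid post where "p (a, b) = pre @ S1 @ mid @ S2 @ post" using dec by blast
    moreover have "gpath (p (a, b))" using ab p[of a b] by (auto simp: L_def)
    ultimately show "distinct S1" "set S1 \<subseteq> pverts G" "distinct (rev S2)" "set (rev S2) \<subseteq> pverts G"
      "set S1 \<inter> set S2 = {}"
      by (auto simp: gpath_def)
  qed
  have len: "13 * M + 2 \<le> length S1" "13 * M + 2 \<le> length (rev S2)" using l(1) S by auto
  obtain X1 where X1: "X1 \<subseteq> set S1" "2 * M \<le> card X1"
    "\<And>x pre. x \<in> X1 \<Longrightarrow> gpath (pre @ S1) \<Longrightarrow> (hd (pre @ S1), x) \<in> parcs G \<Longrightarrow>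
       \<exists>Y\<subseteq>set S1. M \<le> card Y \<and> (\<forall>y\<in>Y. \<exists>Q. gpath Q \<and> set Q = set (pre @ S1) \<and> hd Q = y \<and> last Q = last S1)"
    using many_ends_in_segment[OF M(1,2) S12(1,2) len(1)] by blast
  obtain X2 where X2: "X2 \<subseteq> set (rev S2)" "2 * M \<le> card X2"
    "\<And>x pre. x \<in> X2 \<Longrightarrow> gpath (pre @ rev S2) \<Longrightarrow> (hd (pre @ rev S2), x) \<in> parcs G \<Longrightarrow>
       \<exists>Y\<subseteq>set (rev S2). M \<le> card Y \<and>
         (\<forall>y\<in>Y. \<exists>Q. gpath Q \<and> set Q = set (pre @ rev S2) \<and> hd Q = y \<and> last Q = last (rev S2))"
    using many_ends_in_segment[OF M(1,2) S12(3,4) len(2)] by blast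
  \<comment> \<open>The vertex \<open>a\<close> has to be found before \<open>b\<close>, because the eligible \<open>b\<close> depend on it.\<close>
  obtain a x where a: "M \<le> card (?row a)" "x \<in> X1" "(a, x) \<in> parcs G"
    using joined_edge[OF M(1) _ _ rows X1(2)] X1(1) S12(2) by auto
  obtain b y where b: "(a, b) \<in> L" "y \<in> X2" "(b, y) \<in> parcs G"
    using joined_edge[OF M(1) _ _ a(1) X2(2)] X2(1) S12(4) by auto
  obtain pre mid post where dec_ab: "p (a, b) = pre @ S1 @ mid @ S2 @ post" using dec[OF b(1)] by blast
  have pab: "gpath (p (a, b))" "set (p (a, b)) = set P" "hd (p (a, b)) = a" "last (p (a, b)) = b"
    using p[of a b] b(1) by (auto simp: L_def)
  have ne: "S1 \<noteq> []" "S2 \<noteq> []" using S(1,2) l(1) by auto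
  have g: "gpath ((pre @ S1) @ (mid @ S2 @ post))" using pab(1) dec_ab by simp
  then have g1: "gpath (pre @ S1)" using ne by (subst (asm) gpath_append) (auto split: if_splits)
  have "gpath ((pre @ S1 @ mid) @ (S2 @ post))" using g by simp
  then have "gpath (S2 @ post)" using ne by (subst (asm) gpath_append) (auto split: if_splits)
  then have "gpath (rev (S2 @ post))" by (simp only: gpath_rev)
  then have g2: "gpath (rev post @ rev S2)" by simp
  have "hd (p (a, b)) = hd (pre @ S1)" using ne dec_ab by (cases pre; cases S1) auto
  then have "(hd (pre @ S1), x) \<in> parcs G" using a(3) pab(3) by simp
  from X1(3)[OF a(2) g1 this]
  obtain Y1 where Y1: "Y1 \<subseteq> set S1" "M \<le> card Y1"
    "\<And>y. y \<in> Y1 \<Longrightarrow> \<exists>Q. gpath Q \<and> set Q = set (pre @ S1) \<and> hd Q = y \<and> last Q = last S1" by blast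
  have "last (p (a, b)) = last (S2 @ post)" using ne dec_ab by simp
  then have "hd (rev post @ rev S2) = b" using pab(4) ne by (metis hd_rev rev_append)
  then have "(hd (rev post @ rev S2), y) \<in> parcs G" using b(3) by simp
  from X2(3)[OF b(2) g2 this]
  obtain Y2 where Y2: "Y2 \<subseteq> set S2" "M \<le> card Y2"
    "\<And>y. y \<in> Y2 \<Longrightarrow> \<exists>Q. gpath Q \<and> set Q = set (rev post @ rev S2) \<and> hd Q = y \<and> last Q = last (rev S2)"
    unfolding set_rev[of S2] by blast
  have "\<exists>y1\<in>Y1. \<exists>y2\<in>Y2. (y1, y2) \<in> parcs G"
  proof -
    have "Y1 \<subseteq> pverts G" "Y2 \<subseteq> pverts G" "Y1 \<inter> Y2 = {}" using Y1(1) Y2(1) S12 by auto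
    then show ?thesis using M(1) Y1(2) Y2(2) unfolding joined_def by blast
  qed
  then obtain y1 y2 where y: "y1 \<in> Y1" "y2 \<in> Y2" "(y1, y2) \<in> parcs G" by blast
  obtain Q1 where Q1: "gpath Q1" "set Q1 = set (pre @ S1)" "hd Q1 = y1" "last Q1 = last S1"
    using Y1(3)[OF y(1)] by blast
  obtain Q2 where Q2: "gpath Q2" "set Q2 = set (rev post @ rev S2)" "hd Q2 = y2" "last Q2 = last (rev S2)"
    using Y2(3)[OF y(2)] by blast
  \<comment> \<open>The parts of \<open>p (a, b)\<close> up to the end of \<open>S1\<close> and from the beginning of \<open>S2\<close> are exchanged
  independently of each other, since \<open>Q1\<close> and \<open>Q2\<close> keep their inner ends and their vertex sets.\<close>
  have "gpath (Q1 @ (mid @ S2 @ post))"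
    by (rule replace_prefix[OF g Q1(1,2)]) (use Q1(4) ne in simp)
  then have "gpath (rev (Q1 @ (mid @ S2 @ post)))" by (simp only: gpath_rev)
  then have g3: "gpath ((rev post @ rev S2) @ (rev mid @ rev Q1))" by simp
  have "gpath (Q2 @ (rev mid @ rev Q1))"
    by (rule replace_prefix[OF g3 Q2(1,2)]) (use Q2(4) ne in simp)
  moreover define C where "C = Q2 @ rev mid @ rev Q1"
  ultimately have gC: "gpath C" by simp
  have setC: "set C = set P" using pab(2) dec_ab Q1(2) Q2(2) by (auto simp: C_def)
  have neQ: "Q1 \<noteq> []" "Q2 \<noteq> []" using Q1(1) Q2(1) by (auto simp: gpath_def)
  have "last C = y1" "hd C = y2" using neQ Q1(3) Q2(3) by (auto simp: C_def last_rev)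
  then have closed: "(last C, hd C) \<in> parcs G" using y(3) by simp
  have "card (set P) = length P" using P'(2) by (rule distinct_card)
  then have "M \<le> card (set P)" using lenP M(3) by linarith
  then have span: "set C = pverts G"
    using closed_gpath_spans[OF P gC setC closed M(1) _ m] d by simp
  have "length C = ?n" using gC span by (simp add: gpath_def flip: distinct_card)
  then have "3 \<le> length C" using M(2,3) by linarith
  then show ?thesis by (rule hamiltonian_if_closed_gpath[OF gC closed span])
qed

end

section \<open>Asymptotics of the parameters\<close>

text \<open>
  With \<open>d = y ^ 3\<close> the claim reads \<open>1 \<le> y\<^sup>2 * (y - 2)\<close>, which holds for \<open>9 / 4 \<le> y\<close>. It turns growth by the factor \<open>(d - 1) / 2\<close> into a bound of about \<open>3 / 2 * ln n / ln d\<close> on the number of rounds.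
\<close>
lemma powr_two_thirds_le:
  fixes d :: real
  assumes "12 \<le> d" shows "d powr (2 / 3) \<le> (d - 1) / 2"
proof -
  define y where "y = d powr (1 / 3)"
  have y0: "0 < y" using assms by (simp add: y_def)
  have y3: "y ^ 3 = d" using assms powr_realpow[OF y0, of 3] by (simp add: y_def powr_powr)
  have y2: "d powr (2 / 3) = y\<^sup>2" using assms powr_realpow[OF y0, of 2] by (simp add: y_def powr_powr)
  have "9 / 4 \<le> y"
  proof (rule ccontr)
    assume "\<not> ?thesis"
    then have "y ^ 3 \<le> (9 / 4) ^ 3" by (intro power_mono) (auto simp: y_def)
    also have "\<dots> < (12 :: real)" by (simp add: power3_eq_cube)
    finally show False using assms y3 by simp
  qed
  then have "(9 / 4)\<^sup>2 * (1 / 4) \<le> y\<^sup>2 * (y - 2)"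
    by (intro mult_mono power_mono) auto
  then have "1 \<le> y\<^sup>2 * (y - 2)" by (simp add: power2_eq_square)
  then have "1 \<le> y ^ 3 - 2 * y\<^sup>2" by (simp add: power2_eq_square power3_eq_cube algebra_simps)
  then show ?thesis using y2 y3 by (simp add: field_simps)
qed

lemma eventually_large:
  "\<exists>n0. \<forall>n\<ge>n0. sqrt (real n) \<le> real n / (1035 * ln (real n)) \<and> 1000 \<le> real n / (1035 * ln (real n)) \<and> 1 < real n"
proof -
  have "eventually (\<lambda>n. sqrt (real n) \<le> real n / (1035 * ln (real n))) at_top" by real_asymp
  moreover have "eventually (\<lambda>n. 1000 \<le> real n / (1035 * ln (real n))) at_top" by real_asymp
  moreover have "eventually (\<lambda>n. 1 < real n) at_top" by real_asymp
  ultimately show ?thesis unfolding eventually_at_top_linorder[symmetric] by eventually_elim auto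
qed

text \<open>
  With \<open>L = ln x / ln d\<close>, the first threshold is \<open>\<mu> = x / (1035 * L)\<close> and the second one is
  \<open>\<nu> = 1035 * \<mu> / d\<close>. The condition \<open>d \<le> sqrt x\<close> says \<open>2 \<le> L\<close>, which absorbs the additive constants in
  the number of rounds \<open>t \<approx> 3 / 2 * (L - 1)\<close>. The product of \<open>12 * (t + 2) \<le> 27 * L\<close> and
  \<open>13 * M + 2 \<le> 14 * \<mu>\<close> is then far below \<open>1035 * L * \<mu> = x\<close>. As \<open>x\<close> is large, \<open>\<mu>\<close> is at
  least \<open>d\<close> and at least \<open>1000\<close>, so that rounding \<open>\<mu>\<close> and \<open>\<nu>\<close> to integers does no harm.
\<close>
lemma parameters:
  fixes x d :: real
  assumes x: "sqrt x \<le> x / (1035 * ln x)" "1000 \<le> x / (1035 * ln x)" "1 < x"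
    and d: "12 \<le> d" "d \<le> sqrt x"
  defines "\<mu> \<equiv> x * ln d / (1035 * ln x)" and "\<nu> \<equiv> x * ln d / (d * ln x)"
  obtains M m t :: nat where "\<mu> \<le> real M" "1 \<le> M" "768 * real M \<le> x"
    "real m \<le> \<nu>" "1 \<le> m" "2 * real M \<le> d * real m"
    "real m \<le> ((d - 1) / 2) ^ t" "12 * (real t + 2) * (13 * real M + 2) \<le> x"
proof -
  define L where "L = ln x / ln d"
  have lnx: "0 < ln x" using x(3) by simp
  have "exp 1 \<le> d" using exp_le d(1) by linarith
  then have lnd: "1 \<le> ln d" using d(1) by (subst ln_ge_iff) auto
  have "ln d \<le> ln (sqrt x)" using d x(3) by (subst ln_le_cancel_iff) auto
  also have "\<dots> = ln x / 2" using x(3) by (simp add: ln_sqrt)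
  finally have L2: "2 \<le> L" using lnd by (simp add: L_def field_simps)
  have x_eq: "x = 1035 * L * \<mu>" using lnx lnd by (simp add: L_def \<mu>_def field_simps)
  have \<nu>_eq: "d * \<nu> = 1035 * \<mu>" using d(1) lnx by (simp add: \<nu>_def \<mu>_def field_simps)
  have "x / (1035 * ln x) * 1 \<le> x / (1035 * ln x) * ln d"
    using lnd lnx x(3) by (intro mult_left_mono) auto
  then have "x / (1035 * ln x) \<le> \<mu>" by (simp add: \<mu>_def)
  then have \<mu>: "1000 \<le> \<mu>" "d \<le> \<mu>" using x d(2) by linarith+
  define M where "M = nat \<lceil>\<mu>\<rceil>"
  define m where "m = nat \<lfloor>\<nu>\<rfloor>"
  define t where "t = nat \<lceil>3 / 2 * (L - 1)\<rceil>"
  have M: "\<mu> \<le> M" "M \<le> \<mu> + 1" using \<mu>(1) unfolding M_def by linarith+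
  have "d * 1 \<le> d * \<nu>" using \<nu>_eq \<mu> by linarith
  then have \<nu>1: "1 \<le> \<nu>" using d(1) by (subst (asm) mult_le_cancel_left) auto
  have m: "m \<le> \<nu>" "\<nu> \<le> m + 1" "1 \<le> m" using \<nu>1 unfolding m_def by linarith+
  have "real t = of_int \<lceil>3 / 2 * (L - 1)\<rceil>" using L2 by (simp add: t_def)
  then have t: "3 / 2 * (L - 1) \<le> t" "t \<le> 3 / 2 * (L - 1) + 1"
    using ceiling_correct[of "3 / 2 * (L - 1)"] by linarith+
  have L\<mu>: "2 * \<mu> \<le> L * \<mu>" using L2 \<mu>(1) by (intro mult_right_mono) auto
  show ?thesis
  proof (rule that)
    show "\<mu> \<le> M" by (rule M)
    show "1 \<le> M" using M(1) \<mu>(1) by linarith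
    show "768 * real M \<le> x" using x_eq L\<mu> M(2) \<mu>(1) by linarith
    show "m \<le> \<nu>" "1 \<le> m" by (rule m)+
    have "d * \<nu> \<le> d * (m + 1)" using m(2) d(1) by (intro mult_left_mono) auto
    then have "1035 * \<mu> \<le> d * m + d" using \<nu>_eq by (simp add: algebra_simps)
    then show "2 * real M \<le> d * m" using \<mu> M(2) by linarith
    show "real m \<le> ((d - 1) / 2) ^ t"
    proof -
      have "d * \<nu> = x / L" using x_eq \<nu>_eq L2 by (simp add: field_simps)
      also have "\<dots> \<le> x / 1" using L2 x(3) by (intro divide_left_mono) auto
      finally have "\<nu> \<le> x / d" using d(1) by (simp add: field_simps)
      also have "x = d powr L" using d(1) x(3) lnd by (simp add: powr_def L_def)
      also have "d powr L / d = d powr (L - 1)" using d(1) by (simp add: powr_diff)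
      also have "\<dots> \<le> d powr (2 / 3 * t)" using t(1) d(1) by (intro powr_mono) auto
      also have "\<dots> = (d powr (2 / 3)) ^ t"
        using d(1) powr_realpow[of "d powr (2 / 3)" t] by (simp add: powr_powr)
      also have "\<dots> \<le> ((d - 1) / 2) ^ t" by (intro power_mono powr_two_thirds_le d(1)) simp
      finally show ?thesis using m(1) by linarith
    qed
    have "12 * (real t + 2) * (13 * real M + 2) \<le> (27 * L) * (14 * \<mu>)"
    proof (rule mult_mono)
      show "12 * (real t + 2) \<le> 27 * L" using t(2) L2 by (simp add: field_simps)
      show "13 * real M + 2 \<le> 14 * \<mu>" using M(2) \<mu>(1) by linarith
    qed (use L2 in auto)
    also have "\<dots> \<le> x" using x_eq L\<mu> \<mu>(1) by linarith
    finally show "12 * (real t + 2) * (13 * real M + 2) \<le> x" .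
  qed
qed

theorem theorem2p5:
  shows "\<exists>n0::nat. \<forall>n::nat. n \<ge> n0 \<longrightarrow>
    (\<forall>d::real. 12 \<le> d \<and> d \<le> sqrt (real n) \<longrightarrow>
      (\<forall>G :: 'a pair_pre_digraph.
        pair_graph G \<and> card (pverts G) = n \<and>
        (\<forall>S. S \<subseteq> pverts G \<and> real (card S) \<le> (real n * ln d) / (d * ln (real n)) \<longrightarrow>
           real (card (ext_neighborhood G S)) \<ge> d * real (card S)) \<and>
        (\<forall>A B. A \<subseteq> pverts G \<and> B \<subseteq> pverts G \<and> A \<inter> B = {} \<and>
           real (card A) \<ge> (real n * ln d) / (1035 * ln (real n)) \<and>
           real (card B) \<ge> (real n * ln d) / (1035 * ln (real n)) \<longrightarrow>
           (\<exists>a\<in>A. \<exists>b\<in>B. (a, b) \<in> parcs G))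
        \<longrightarrow> hamiltonian G))"
proof -
  obtain n0 where n0: "\<forall>n\<ge>n0. sqrt (real n) \<le> real n / (1035 * ln (real n)) \<and>
      1000 \<le> real n / (1035 * ln (real n)) \<and> 1 < real n"
    using eventually_large by blast
  show ?thesis
  proof (intro exI[of _ n0] allI impI; elim conjE)
    fix n :: nat and d :: real and G :: "'a pair_pre_digraph"
    assume n: "n0 \<le> n" and d: "12 \<le> d" "d \<le> sqrt (real n)"
      and G: "pair_graph G" "card (pverts G) = n"
      and expansion: "\<forall>S. S \<subseteq> pverts G \<and> real (card S) \<le> (real n * ln d) / (d * ln (real n)) \<longrightarrow>
           real (card (ext_neighborhood G S)) \<ge> d * real (card S)"
      and join: "\<forall>A B. A \<subseteq> pverts G \<and> B \<subseteq> pverts G \<and> A \<inter> B = {} \<and>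
           real (card A) \<ge> (real n * ln d) / (1035 * ln (real n)) \<and>
           real (card B) \<ge> (real n * ln d) / (1035 * ln (real n)) \<longrightarrow>
           (\<exists>a\<in>A. \<exists>b\<in>B. (a, b) \<in> parcs G)"
    interpret pair_graph G by (rule G(1))
    obtain M m t :: nat where M: "real n * ln d / (1035 * ln (real n)) \<le> real M" "1 \<le> M" "768 * real M \<le> real n"
      and m: "real m \<le> real n * ln d / (d * ln (real n))" "1 \<le> m" "2 * real M \<le> d * real m"
      and t: "real m \<le> ((d - 1) / 2) ^ t" "12 * (real t + 2) * (13 * real M + 2) \<le> real n"
      using parameters[of "real n" d] n0 n d by blast
    have "joined M"
      unfolding joined_def
    proof (intro allI impI)
      fix A B
      assume AB: "A \<subseteq> pverts G \<and> B \<subseteq> pverts G \<and> A \<inter> B = {} \<and> M \<le> card A \<and> M \<le> card B"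
      then have "real M \<le> real (card A)" "real M \<le> real (card B)" by simp_all
      then show "\<exists>a\<in>A. \<exists>b\<in>B. (a, b) \<in> parcs G" using join AB M(1) by (meson order_trans)
    qed
    moreover have "expands m d"
      unfolding expands_def
    proof (intro allI impI)
      fix S assume S: "S \<subseteq> pverts G \<and> card S \<le> m"
      then have "real (card S) \<le> real m" by simp
      then show "d * real (card S) \<le> real (card (ext_neighborhood G S))"
        using expansion S m(1) by (meson order_trans)
    qed
    moreover have "768 * M \<le> card (pverts G)" using M(3) G(2) by linarith
    moreover have "12 * (t + 2) * (13 * M + 2) \<le> card (pverts G)"
    proof -
      have "real (12 * (t + 2) * (13 * M + 2)) \<le> real n" using t(2) by (simp add: algebra_simps)
      then show ?thesis using G(2) by (simp only: of_nat_le_iff)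
    qed
    ultimately show "hamiltonian G"
      using hamiltonian_if_expanding M(2) m(2,3) d(1) t(1) by blast
  qed
qed

end
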